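(* Let $X$ and $Y$ be Banach spaces such that $X^{*}$ is of cotype 2. Let $\Omega$ be a compact Hausdorff space. Assume that $S\in\mathcal{L}(\mathcal{C}(\Omega),\mathcal{L}(X,Y))$. Then, for each $p$ with $1\leq p\leq 2$, there exists an operator $U\in\mathcal{L}(\mathcal{C}_{p}(\Omega,X),Y)$ such that $U^{\#}=S$.
   Context: All Banach spaces are over the same field $\mathbb{K}$ ($\mathbb{R}$ or $\mathbb{C}$); $\mathcal{L}(X,Y)$ is the Banach space of bounded linear operators; $p'$ is the conjugate index, $1/p+1/p'=1$ with $1/\infty=0$. $\mathcal{C}(\Omega)$ and $\mathcal{C}(\Omega,X)$ are the spaces of continuous $\mathbb{K}$-valued and $X$-valued functions on $\Omega$ with the supremum norm. $\mathcal{C}_p(\Omega,X)$ ($1\le p<\infty$), the Banach space of $p$-continuous $X$-valued functions, consists of all $f\in\mathcal{C}(\Omega,X)$ for which there is a sequence $(x_n)\in\ell_p(X)$ with $f(\Omega)\subset\{\sum_n\alpha_nx_n:(\alpha_n)\in B_{\ell_{p'}}\}$, where $B_{\ell_{p'}}$ is the closed unit ball of $\ell_{p'}$; its norm is $\|f\|_{\mathcal{C}_p(\Omega,X)}=\inf\|(x_n)\|_p$ over all such sequences. It is known that $\mathcal{C}_p(\Omega,X)=\mathcal{C}(\Omega)\hat{\otimes}_{d_p}X$ as Banach spaces via $\varphi x\leftrightarrow\varphi\otimes x$, where $\varphi x$ is the function $\omega\mapsto\varphi(\omega)x$ and $d_p$ is the right Chevet--Saphar tensor norm: for $u\in Z\otimes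 X$, $d_p(u)=\inf\{\|(z_i)\|_{p'}^w\,\|(x_i)\|_p: u=\sum_{i=1}^n z_i\otimes x_i\}$, with $\|(x_i)\|_p=(\sum\|x_i\|^p)^{1/p}$ and $\|(z_i)\|_{q}^w=\sup_{z^*\in B_{Z^*}}(\sum|z^*(z_i)|^{q})^{1/q}$ (usual suprema for the index $\infty$). For $U\in\mathcal{L}(\mathcal{C}_p(\Omega,X),Y)$, the associated operator $U^{\#}\in\mathcal{L}(\mathcal{C}(\Omega),\mathcal{L}(X,Y))$ is $(U^{\#}\varphi)x=U(\varphi x)$. Cotype is the usual Rademacher cotype. *)

theory Defs
  imports "HOL-Analysis.Analysis"
begin

text \<open>
  A field in this class is a copy of the real numbers (first disjunct) or of the complex
  numbers (second disjunct), with the usual absolute value as norm.  A statement about an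
  arbitrary type of this class therefore covers exactly real and complex scalars.
\<close>

class real_or_complex = real_normed_field +
  assumes real_or_complex:
    "(\<forall>z. \<exists>a. z = a *\<^sub>R 1) \<or>
     (\<exists>i. i * i = - 1 \<and>
       (\<forall>z. \<exists>a b. z = a *\<^sub>R 1 + b *\<^sub>R i \<and> norm z = sqrt (a\<^sup>2 + b\<^sup>2)))"

instance real :: real_or_complex
  by standard auto

instance complex :: real_or_complex
proof
  have "z = Re z *\<^sub>R 1 + Im z *\<^sub>R \<i> \<and> norm z = sqrt ((Re z)\<^sup>2 + (Im z)\<^sup>2)" for z
    by (simp add: complex_eq_iff cmod_def)
  moreover have "\<i> * \<i> = - 1"
    by simp
  ultimately show "(\<forall>z::complex. \<exists>a. z = a *\<^sub>R 1) \<or>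
     (\<exists>i::complex. i * i = - 1 \<and>
       (\<forall>z. \<exists>a b. z = a *\<^sub>R 1 + b *\<^sub>R i \<and> norm z = sqrt (a\<^sup>2 + b\<^sup>2)))"
    by blast
qed

text \<open>
  A normed space over the scalar field is a type of class \<^class>\<open>real_normed_vector\<close> together with a
  scalar multiplication extending \<^const>\<open>scaleR\<close>; it is a Banach space if the type is
  of class \<^class>\<open>banach\<close>.
\<close>

locale normed_over = vector_space scale
  for scale :: "'k::real_or_complex \<Rightarrow> 'a::real_normed_vector \<Rightarrow> 'a" +
  assumes scale_of_real: "scale (of_real r) x = r *\<^sub>R x"
    and norm_scale: "norm (scale c x) = norm c * norm x"

lemma normed_over_mult: "normed_over ((*) :: 'k::real_or_complex \<Rightarrow> 'k \<Rightarrow> 'k)"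
  by unfold_locales (simp_all add: algebra_simps norm_mult scaleR_conv_of_real)

text \<open>
  The type \<open>'a \<Rightarrow>\<^sub>L 'b\<close> consists of the bounded real-linear maps, with the operator norm;
  the space of bounded operators over the scalar field is the following subspace of it.
\<close>

definition operators ::
    "('k::real_or_complex \<Rightarrow> 'a::real_normed_vector \<Rightarrow> 'a) \<Rightarrow>
     ('k \<Rightarrow> 'b::real_normed_vector \<Rightarrow> 'b) \<Rightarrow> ('a \<Rightarrow>\<^sub>L 'b) set" where
  "operators scaleA scaleB = {T. Vector_Spaces.linear scaleA scaleB (blinfun_apply T)}"

definition dual_space ::
    "('k::real_or_complex \<Rightarrow> 'a::real_normed_vector \<Rightarrow> 'a) \<Rightarrow> ('a \<Rightarrow>\<^sub>L 'k) set" where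
  "dual_space scaleA = operators scaleA (*)"

definition scale_blinfun ::
    "('k::real_or_complex \<Rightarrow> 'b::real_normed_vector \<Rightarrow> 'b) \<Rightarrow>
     'k \<Rightarrow> ('a::real_normed_vector \<Rightarrow>\<^sub>L 'b) \<Rightarrow> ('a \<Rightarrow>\<^sub>L 'b)" where
  "scale_blinfun scaleB c T = Blinfun (\<lambda>x. scaleB c (blinfun_apply T x))"

text \<open>
  On a compact space \<open>'o\<close> every continuous function is bounded, so that \<open>'o \<Rightarrow>\<^sub>C 'a\<close> is the
  space of all continuous functions with the supremum norm.
\<close>

definition scale_bcontfun ::
    "('k::real_or_complex \<Rightarrow> 'a::real_normed_vector \<Rightarrow> 'a) \<Rightarrow>
     'k \<Rightarrow> ('o::topological_space \<Rightarrow>\<^sub>C 'a) \<Rightarrow> ('o \<Rightarrow>\<^sub>C 'a)" where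
  "scale_bcontfun scaleA c f = Bcontfun (\<lambda>\<omega>. scaleA c (apply_bcontfun f \<omega>))"

text \<open>The function \<open>\<omega> \<mapsto> \<phi>(\<omega>) x\<close>.\<close>

definition scalar_times ::
    "('k::real_or_complex \<Rightarrow> 'a::real_normed_vector \<Rightarrow> 'a) \<Rightarrow>
     ('o::topological_space \<Rightarrow>\<^sub>C 'k) \<Rightarrow> 'a \<Rightarrow> ('o \<Rightarrow>\<^sub>C 'a)" where
  "scalar_times scaleA \<phi> x = Bcontfun (\<lambda>\<omega>. scaleA (apply_bcontfun \<phi> \<omega>) x)"

context normed_over
begin

lemma bounded_linear_scale: "bounded_linear (scale c)"
proof
  show "scale c (r *\<^sub>R x) = r *\<^sub>R scale c x" for r x
    by (metis scale_left_commute scale_of_real)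
  show "\<exists>K. \<forall>x. norm (scale c x) \<le> norm x * K"
    by (intro exI[of _ "norm c"]) (simp add: norm_scale)
qed (simp add: scale_right_distrib)

lemma bounded_linear_scale_left: "bounded_linear (\<lambda>c. scale c x)"
proof
  show "scale (r *\<^sub>R c) x = r *\<^sub>R scale c x" for r c
    by (metis scale_of_real scale_scale scaleR_conv_of_real)
  show "\<exists>K. \<forall>c. norm (scale c x) \<le> norm c * K"
    by (intro exI[of _ "norm x"]) (simp add: norm_scale)
qed (simp add: scale_left_distrib)

lemma apply_scale_blinfun: "blinfun_apply (scale_blinfun scale c T) x = scale c (blinfun_apply T x)"
proof -
  have "bounded_linear (\<lambda>x. scale c (blinfun_apply T x))"
    by (rule bounded_linear_compose[OF bounded_linear_scale blinfun.bounded_linear_right])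
  then show ?thesis
    by (simp add: scale_blinfun_def bounded_linear_Blinfun_apply)
qed

lemma bcontfun_linear_image:
  assumes "bounded_linear L"
  shows "(\<lambda>\<omega>. L (apply_bcontfun f \<omega>)) \<in> bcontfun"
proof -
  have "continuous_on UNIV (\<lambda>\<omega>. L (apply_bcontfun f \<omega>))"
    by (intro bounded_linear.continuous_on[OF assms] continuous_on_apply_bcontfun)
  moreover have "bounded (range (\<lambda>\<omega>. L (apply_bcontfun f \<omega>)))"
    using bounded_linear_image[OF bounded_apply_bcontfun assms]
    by (auto simp: image_image)
  ultimately show ?thesis
    by (simp add: bcontfun_def)
qed

lemma apply_scale_bcontfun:
  "apply_bcontfun (scale_bcontfun scale c f) \<omega> = scale c (apply_bcontfun f \<omega>)"
  by (simp add: scale_bcontfun_def Bcontfun_inverse bcontfun_linear_image bounded_linear_scale)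

lemma apply_scalar_times:
  "apply_bcontfun (scalar_times scale \<phi> x) \<omega> = scale (apply_bcontfun \<phi> \<omega>) x"
  by (simp add: scalar_times_def Bcontfun_inverse
      bcontfun_linear_image[OF bounded_linear_scale_left])

lemma normed_over_scale_blinfun:
  "normed_over (scale_blinfun scale :: 'k \<Rightarrow> ('c::real_normed_vector \<Rightarrow>\<^sub>L 'a) \<Rightarrow> _)"
proof
  show "norm (scale_blinfun scale c T) = norm c * norm T" for c and T :: "'c \<Rightarrow>\<^sub>L 'a"
  proof (cases "c = 0")
    case True
    then have "scale_blinfun scale c T = 0"
      by (intro blinfun_eqI) (simp add: apply_scale_blinfun)
    with True show ?thesis by simp
  next
    case False
    have le: "norm (scale_blinfun scale c T) \<le> norm c * norm T" for c and T :: "'c \<Rightarrow>\<^sub>L 'a"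
      by (rule norm_blinfun_bound)
        (auto simp: apply_scale_blinfun norm_scale mult.assoc intro!: mult_left_mono norm_blinfun)
    have "T = scale_blinfun scale (inverse c) (scale_blinfun scale c T)"
      using False by (intro blinfun_eqI) (simp add: apply_scale_blinfun)
    then have "norm T \<le> norm (inverse c) * norm (scale_blinfun scale c T)"
      by (metis le)
    then have "norm c * norm T \<le> norm (scale_blinfun scale c T)"
      using False by (simp add: norm_divide field_simps)
    with le show ?thesis by (meson antisym)
  qed
qed (auto intro!: blinfun_eqI simp: apply_scale_blinfun blinfun.add_left blinfun.scaleR_left
    scale_right_distrib scale_left_distrib scale_of_real)

lemma normed_over_scale_bcontfun:
  "normed_over (scale_bcontfun scale :: 'k \<Rightarrow> ('o::topological_space \<Rightarrow>\<^sub>C 'a) \<Rightarrow> _)"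
proof
  show "norm (scale_bcontfun scale c f) = norm c * norm f" for c and f :: "'o \<Rightarrow>\<^sub>C 'a"
  proof (cases "c = 0")
    case True
    then have "scale_bcontfun scale c f = 0"
      by (intro bcontfun_eqI) (simp add: apply_scale_bcontfun)
    with True show ?thesis by simp
  next
    case False
    have le: "norm (scale_bcontfun scale c f) \<le> norm c * norm f" for c and f :: "'o \<Rightarrow>\<^sub>C 'a"
      by (rule norm_bound)
        (auto simp: apply_scale_bcontfun norm_scale intro!: mult_left_mono norm_bounded)
    have "f = scale_bcontfun scale (inverse c) (scale_bcontfun scale c f)"
      using False by (intro bcontfun_eqI) (simp add: apply_scale_bcontfun)
    then have "norm f \<le> norm (inverse c) * norm (scale_bcontfun scale c f)"
      by (metis le)
    then have "norm c * norm f \<le> norm (scale_bcontfun scale c f)"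
      using False by (simp add: norm_divide field_simps)
    with le show ?thesis by (meson antisym)
  qed
qed (auto intro!: bcontfun_eqI simp: apply_scale_bcontfun
    scale_right_distrib scale_left_distrib scale_of_real)

end

text \<open>
  The expectation over independent random signs is written out as the mean over all \<open>2 ^ n\<close>
  choices of signs.  The set \<open>V\<close> is meant to be a subspace, with the norm of the type.
\<close>

definition has_cotype :: "real \<Rightarrow> 'a::real_normed_vector set \<Rightarrow> bool" where
  "has_cotype q V \<longleftrightarrow>
    (\<exists>C. \<forall>n. \<forall>v::nat \<Rightarrow> 'a. (\<forall>i<n. v i \<in> V) \<longrightarrow>
      (\<Sum>i<n. norm (v i) powr q) powr (1 / q) \<le>
        C * sqrt ((\<Sum>\<epsilon> \<in> {..<n} \<rightarrow>\<^sub>E {- 1, 1::real}. (norm (\<Sum>i<n. \<epsilon> i *\<^sub>R v i))\<^sup>2) / 2 ^ n))"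

definition in_lp :: "ereal \<Rightarrow> (nat \<Rightarrow> 'a::real_normed_vector) \<Rightarrow> bool" where
  "in_lp q a \<longleftrightarrow>
    (if q = \<infinity> then bounded (range a) else summable (\<lambda>n. norm (a n) powr real_of_ereal q))"

definition lp_norm :: "ereal \<Rightarrow> (nat \<Rightarrow> 'a::real_normed_vector) \<Rightarrow> real" where
  "lp_norm q a =
    (if q = \<infinity> then (SUP n. norm (a n))
     else (\<Sum>n. norm (a n) powr real_of_ereal q) powr (1 / real_of_ereal q))"

text \<open>Inverses are taken in the extended reals, so that \<open>1\<close> and \<open>\<infinity>\<close> are conjugate.\<close>

definition conj_index :: "ereal \<Rightarrow> ereal" where
  "conj_index p = inverse (1 - inverse p)"

lemma conj_index_1: "conj_index 1 = \<infinity>"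
  by (simp add: conj_index_def one_ereal_def)

lemma conj_index_infinity: "conj_index \<infinity> = 1"
  by (simp add: conj_index_def one_ereal_def)

lemma conj_index_real: "1 < p \<Longrightarrow> conj_index (ereal p) = ereal (p / (p - 1))"
  by (auto simp: conj_index_def one_ereal_def divide_simps)

definition lp_ball :: "ereal \<Rightarrow> (nat \<Rightarrow> 'a::real_normed_vector) set" where
  "lp_ball q = {a. in_lp q a \<and> lp_norm q a \<le> 1}"

definition p_hull ::
    "real \<Rightarrow> ('k::real_or_complex \<Rightarrow> 'a::real_normed_vector \<Rightarrow> 'a) \<Rightarrow> (nat \<Rightarrow> 'a) \<Rightarrow> 'a set" where
  "p_hull p scaleA x =
    {y. \<exists>\<alpha> \<in> lp_ball (conj_index (ereal p)). (\<lambda>n. scaleA (\<alpha> n) (x n)) sums y}"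

definition Cp_space ::
    "real \<Rightarrow> ('k::real_or_complex \<Rightarrow> 'a::real_normed_vector \<Rightarrow> 'a) \<Rightarrow>
     ('o::topological_space \<Rightarrow>\<^sub>C 'a) set" where
  "Cp_space p scaleA =
    {f. \<exists>x. in_lp (ereal p) x \<and> range (apply_bcontfun f) \<subseteq> p_hull p scaleA x}"

definition Cp_norm ::
    "real \<Rightarrow> ('k::real_or_complex \<Rightarrow> 'a::real_normed_vector \<Rightarrow> 'a) \<Rightarrow>
     ('o::topological_space \<Rightarrow>\<^sub>C 'a) \<Rightarrow> real" where
  "Cp_norm p scaleA f =
    Inf {lp_norm (ereal p) x | x.
      in_lp (ereal p) x \<and> range (apply_bcontfun f) \<subseteq> p_hull p scaleA x}"

text \<open>
  The bounded operators from the space of $p$-continuous functions, with its own norm, to another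
  space.  They are represented by functions of which only the restriction to
  \<^const>\<open>Cp_space\<close> matters.
\<close>

definition Cp_operators ::
    "real \<Rightarrow> ('k::real_or_complex \<Rightarrow> 'a::real_normed_vector \<Rightarrow> 'a) \<Rightarrow>
     ('k \<Rightarrow> 'b::real_normed_vector \<Rightarrow> 'b) \<Rightarrow> (('o::topological_space \<Rightarrow>\<^sub>C 'a) \<Rightarrow> 'b) set" where
  "Cp_operators p scaleA scaleB =
    {U. (\<forall>f \<in> Cp_space p scaleA. \<forall>g \<in> Cp_space p scaleA. U (f + g) = U f + U g) \<and>
        (\<forall>c. \<forall>f \<in> Cp_space p scaleA. U (scale_bcontfun scaleA c f) = scaleB c (U f)) \<and>
        (\<exists>B. \<forall>f \<in> Cp_space p scaleA. norm (U f) \<le> B * Cp_norm p scaleA f)}"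

lemma lp_single:
  fixes a :: "'a::real_normed_vector"
  assumes "1 \<le> q"
  shows "in_lp q (\<lambda>n. if n = 0 then a else 0)"
    and "lp_norm q (\<lambda>n. if n = 0 then a else 0) = norm a"
proof -
  let ?a = "\<lambda>n::nat. if n = 0 then a else 0"
  have "in_lp q ?a \<and> lp_norm q ?a = norm a"
  proof (cases q)
    case (real r)
    with assms have r: "1 \<le> r"
      by simp
    have eq: "norm (?a n) powr r = (if n = 0 then norm a powr r else 0)" for n
      by simp
    have "(\<lambda>n. norm (?a n) powr r) sums (norm a powr r)"
      unfolding eq by (rule sums_single)
    with r real show ?thesis
      by (auto simp: in_lp_def lp_norm_def sums_iff powr_powr)
  next
    case PInf
    have "bounded (range ?a)"
      by (rule finite_imp_bounded, rule finite_subset[of _ "{a, 0}"]) auto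
    moreover have "(SUP n. norm (?a n)) = norm a"
      by (rule cSup_eq_maximum) (auto intro: rev_image_eqI[of 0])
    ultimately show ?thesis
      using PInf by (simp add: in_lp_def lp_norm_def)
  qed (use assms in simp)
  then show "in_lp q ?a" and "lp_norm q ?a = norm a"
    by auto
qed

lemma conj_index_ge_1: "1 \<le> p \<Longrightarrow> 1 \<le> conj_index (ereal p)"
  using conj_index_real[of p] conj_index_1
  by (cases "p = 1") (auto simp: one_ereal_def)

lemma (in normed_over) scalar_times_in_Cp_space:
  assumes "1 \<le> p"
  shows "scalar_times scale \<phi> x \<in> Cp_space p scale"
proof -
  let ?x = "\<lambda>n::nat. if n = 0 then norm \<phi> *\<^sub>R x else 0"
  have "in_lp (ereal p) ?x"
    using assms by (intro lp_single) simp
  moreover have "apply_bcontfun (scalar_times scale \<phi> x) \<omega> \<in> p_hull p scale ?x" for \<omega>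
  proof -
    let ?c = "inverse (norm \<phi>) *\<^sub>R apply_bcontfun \<phi> \<omega>"
    let ?\<alpha> = "\<lambda>n::nat. if n = 0 then ?c else 0"
    have "norm ?c \<le> 1"
      using norm_bounded[of \<phi> \<omega>] by (cases "norm \<phi> = 0") (auto simp: field_simps)
    then have "?\<alpha> \<in> lp_ball (conj_index (ereal p))"
      using lp_single[OF conj_index_ge_1[OF assms], of ?c] by (simp add: lp_ball_def)
    moreover have eq: "(\<lambda>n. scale (?\<alpha> n) (?x n)) = (\<lambda>n. if n = 0 then scale ?c (norm \<phi> *\<^sub>R x) else 0)"
      by auto
    have "(\<lambda>n. scale (?\<alpha> n) (?x n)) sums scale ?c (norm \<phi> *\<^sub>R x)"
      unfolding eq by (rule sums_single)
    moreover have "scale ?c (norm \<phi> *\<^sub>R x) = apply_bcontfun (scalar_times scale \<phi> x) \<omega>"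
    proof (cases "\<phi> = 0")
      case False
      have "scale ?c (norm \<phi> *\<^sub>R x) = scale (?c * of_real (norm \<phi>)) x"
        by (metis scale_of_real scale_scale)
      also have "?c * of_real (norm \<phi>) = apply_bcontfun \<phi> \<omega>"
        using False by (simp add: scaleR_conv_of_real)
      finally show ?thesis
        by (simp add: apply_scalar_times)
    qed (simp add: apply_scalar_times)
    ultimately show ?thesis
      unfolding p_hull_def by auto
  qed
  ultimately show ?thesis
    unfolding Cp_space_def by blast
qed

definition sharp ::
    "('k::real_or_complex \<Rightarrow> 'a::real_normed_vector \<Rightarrow> 'a) \<Rightarrow>
     (('o::topological_space \<Rightarrow>\<^sub>C 'a) \<Rightarrow> 'b) \<Rightarrow> ('o \<Rightarrow>\<^sub>C 'k) \<Rightarrow> 'a \<Rightarrow> 'b" where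
  "sharp scaleA U \<phi> x = U (scalar_times scaleA \<phi> x)"

end

theory Submission
  imports Defs
begin

text \<open>
  The operator \<open>U\<close> is integration against \<open>S\<close>: \<open>U f\<close> is the limit of the Riemann sums
  \<open>\<Sum>\<^sub>w S(\<psi>\<^sub>w) f(w)\<close> over partitions of unity \<open>\<psi>\<close> with tag points \<open>w\<close>.  Such a sum only sees the
  operators \<open>S(\<psi>\<^sub>w)\<close>, that is an operator on a finite-dimensional \<open>\<ell>\<^sub>\<infinity>\<close>.  Composed with a functional
  on \<open>Y\<close> it takes values in \<open>X\<^sup>*\<close>, which has cotype 2, so that it is 2-summing with a constant that
  does not depend on the dimension (Maurey).  As \<open>p \<le> 2\<close>, this bounds the Riemann sums by a multiple
  of \<open>\<parallel>(x\<^sub>n)\<parallel>\<^sub>p\<close> whenever \<open>f\<close> has values in the \<open>p\<close>-hull of \<open>(x\<^sub>n)\<close>.  For the convergence, compactness of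
  the unit ball of \<open>\<ell>\<^sub>p\<^sub>'\<close> under coordinatewise convergence shows that a difference of two values
  of \<open>f\<close> that is small in norm is also small as a \<open>p\<close>-combination.
\<close>

subsection \<open>The Hahn--Banach theorem\<close>

text \<open>The obstacle is that closeness of the values of \<open>f\<close> does not by itself make
  a Riemann sum small: estimating its terms one by one produces the sum of the norms of the
  operators \<open>S(\<psi>\<^sub>w)\<close>, which need not stay bounded over all partitions.
  Uniformly bounded are only the combinations of these operators with coefficients of modulus at
  most 1. Control by the norm of \<open>(x\<^sub>n)\<close> in \<open>\<ell>\<^sub>p\<close> comes
  from a weighting: with \<open>s\<^sub>n\<close> the norm of \<open>x\<^sub>n\<close> divided by a
  bound R of the p-norm, the product of \<open>\<alpha>\<^sub>n\<close> and the norm of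
  \<open>x\<^sub>n\<close> is R times \<open>s\<^sub>n powr (1 - p/2)\<close> times
  \<open>\<alpha>\<^sub>n\<close> times \<open>s\<^sub>n powr (p/2)\<close>. The weighted
  coefficients lie in the unit ball of \<open>\<ell>\<^sub>2\<close>, as a 2-summing estimate
  requires, and so do the remaining weights. The coefficients of a value of \<open>f\<close> are
  neither unique nor chosen continuously. A difference of coefficients is therefore first corrected
  by a difference that represents 0; afterwards finitely many coordinates are small and the rest
  belongs to a tail of \<open>(x\<^sub>n)\<close>. All estimates are carried out over the reals, at
  the price of larger constants.\<close>

definition sublinear :: "('a::real_vector \<Rightarrow> real) \<Rightarrow> bool" where
  "sublinear q \<longleftrightarrow> (\<forall>x y. q (x + y) \<le> q x + q y) \<and> (\<forall>r x. 0 \<le> r \<longrightarrow> q (r *\<^sub>R x) = r * q x)"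

text \<open>One inequality suffices for homogeneity: applied to \<open>inverse r\<close> and
  \<open>r *\<^sub>R x\<close> it gives the reverse one.\<close>

lemma sublinearI:
  assumes "\<And>x y. q (x + y) \<le> q x + q y" and "\<And>r x. 0 < r \<Longrightarrow> q (r *\<^sub>R x) \<le> r * q x" and "q 0 = 0"
  shows "sublinear q"
  unfolding sublinear_def
proof (intro conjI allI impI assms(1))
  fix r :: real and x assume "0 \<le> r"
  show "q (r *\<^sub>R x) = r * q x"
  proof (cases "r = 0")
    case False
    with \<open>0 \<le> r\<close> have r: "0 < r" by simp
    have "q (inverse r *\<^sub>R (r *\<^sub>R x)) \<le> inverse r * q (r *\<^sub>R x)"
      using r by (intro assms(2)) simp
    then have "r * q x \<le> q (r *\<^sub>R x)"
      using r by (simp add: field_simps)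
    with assms(2)[OF r, of x] show ?thesis by simp
  qed (use assms(3) in simp)
qed

lemma sublinear_add: "sublinear q \<Longrightarrow> q (x + y) \<le> q x + q y"
  and sublinear_scale: "sublinear q \<Longrightarrow> 0 \<le> r \<Longrightarrow> q (r *\<^sub>R x) = r * q x"
  by (auto simp: sublinear_def)

lemma sublinear_0: "sublinear q \<Longrightarrow> q 0 = 0"
  using sublinear_scale[of q 0 0] by simp

lemma sublinear_minus: "sublinear q \<Longrightarrow> - q (- x) \<le> q x"
  using sublinear_add[of q x "- x"] sublinear_0[of q] by simp

text \<open>\<open>q'\<close> is the largest sublinear functional below \<open>q\<close> with
  \<open>q' (- v) \<le> - c\<close>, so every linear functional below \<open>q'\<close> takes a
  value of at least \<open>c\<close> at \<open>v\<close>. The infimum is finite because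
  \<open>- q (- x)\<close> bounds it from below, and this is where \<open>c \<le> q v\<close>
  enters.\<close>

lemma sublinear_INF_ray:
  assumes q: "sublinear q" and c: "c \<le> q v"
  defines "q' \<equiv> \<lambda>x. INF t\<in>{0..}. q (x + t *\<^sub>R v) - t * c"
  shows "sublinear q'" and "\<And>x t. 0 \<le> t \<Longrightarrow> q' x \<le> q (x + t *\<^sub>R v) - t * c"
proof -
  have "- q (- x) \<le> q (x + t *\<^sub>R v) - t * c" if "0 \<le> t" for x t
  proof -
    have "t * c \<le> t * q v" using that c by (rule mult_left_mono[rotated])
    also have "\<dots> = q ((x + t *\<^sub>R v) + (- x))"
      using sublinear_scale[OF q that] by simp
    also have "\<dots> \<le> q (x + t *\<^sub>R v) + q (- x)" by (rule sublinear_add[OF q])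
    finally show ?thesis by simp
  qed
  then have bdd: "bdd_below ((\<lambda>t. q (x + t *\<^sub>R v) - t * c) ` {0..})" for x
    by (intro bdd_belowI2[of _ "- q (- x)"]) simp
  show le: "q' x \<le> q (x + t *\<^sub>R v) - t * c" if "0 \<le> t" for x t
    unfolding q'_def using that by (intro cINF_lower[OF bdd]) simp
  show "sublinear q'"
  proof (rule sublinearI)
    fix x y
    have "q' (x + y) - (q (x + t *\<^sub>R v) - t * c) \<le> q (y + s *\<^sub>R v) - s * c" if "0 \<le> t" "0 \<le> s" for s t
      using le[of "t + s" "x + y"] sublinear_add[OF q, of "x + t *\<^sub>R v" "y + s *\<^sub>R v"] that
      by (simp add: algebra_simps)
    then have "q' (x + y) - (q (x + t *\<^sub>R v) - t * c) \<le> q' y" if "0 \<le> t" for t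
      unfolding q'_def using that by (intro cINF_greatest) auto
    then have "q' (x + y) - q' y \<le> q (x + t *\<^sub>R v) - t * c" if "0 \<le> t" for t
      using that by (smt (verit))
    then have "q' (x + y) - q' y \<le> q' x"
      unfolding q'_def by (intro cINF_greatest) auto
    then show "q' (x + y) \<le> q' x + q' y" by simp
  next
    fix r :: real and x assume r: "0 < r"
    have "q' (r *\<^sub>R x) / r \<le> q (x + t *\<^sub>R v) - t * c" if "0 \<le> t" for t
    proof -
      have "q' (r *\<^sub>R x) \<le> q (r *\<^sub>R x + (r * t) *\<^sub>R v) - (r * t) * c"
        using r that by (intro le) simp
      also have "r *\<^sub>R x + (r * t) *\<^sub>R v = r *\<^sub>R (x + t *\<^sub>R v)"
        by (simp add: scaleR_add_right)
      also have "q \<dots> = r * q (x + t *\<^sub>R v)" using r by (intro sublinear_scale[OF q]) simp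
      finally show ?thesis using r by (simp add: field_simps)
    qed
    then have "q' (r *\<^sub>R x) / r \<le> q' x"
      unfolding q'_def by (intro cINF_greatest) auto
    then show "q' (r *\<^sub>R x) \<le> r * q' x" using r by (simp add: field_simps)
  next
    have "q (t *\<^sub>R v) - t * c \<ge> 0" if "0 \<le> t" for t
      using sublinear_scale[OF q that] c that by (simp add: mult_left_mono)
    then have "q' 0 \<ge> 0"
      unfolding q'_def by (intro cINF_greatest) auto
    moreover have "q' 0 \<le> 0" using le[of 0 0] sublinear_0[OF q] by simp
    ultimately show "q' 0 = 0" by simp
  qed
qed

text \<open>Zorn's lemma for the reversed pointwise order. A nonempty chain has its pointwise
  infimum as lower bound; it is finite since every member lies above \<open>- q0 (- x)\<close> at
  \<open>x\<close>.\<close>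

lemma minimal_sublinear_exists:
  assumes q0: "sublinear q0"
  obtains q where "sublinear q" "q \<le> q0" "\<forall>q'. sublinear q' \<longrightarrow> q' \<le> q \<longrightarrow> q' = q"
proof -
  define A where "A = {q. sublinear q \<and> q \<le> q0}"
  have "\<exists>m\<in>A. \<forall>a\<in>A. a \<le> m \<longrightarrow> a = m"
  proof (rule predicate_Zorn[where P = "\<lambda>a u. u \<le> a"])
    show "partial_order_on A (relation_of (\<lambda>a u. u \<le> a) A)"
      by (rule partial_order_on_relation_ofI) (blast intro: order_refl, erule (1) order_trans, erule (1) order_antisym[rotated])
  next
    fix C assume C: "C \<in> Chains (relation_of (\<lambda>a u. u \<le> a) A)"
    then have CA: "C \<subseteq> A" and cmp: "\<And>a b. a \<in> C \<Longrightarrow> b \<in> C \<Longrightarrow> a \<le> b \<or> b \<le> a"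
      unfolding Chains_def relation_of_def by blast+
    show "\<exists>u\<in>A. \<forall>a\<in>C. u \<le> a"
    proof (cases "C = {}")
      case True
      then show ?thesis using q0 by (auto simp: A_def)
    next
      case False
      define u where "u x = (INF q\<in>C. q x)" for x
      have "- q0 (- x) \<le> q x" if "q \<in> C" for q x
      proof -
        have "q \<le> q0" "sublinear q" using that CA by (auto simp: A_def)
        then show ?thesis using sublinear_minus[of q x] le_funD[of q q0 "- x"] by linarith
      qed
      then have bdd: "bdd_below ((\<lambda>q. q x) ` C)" for x
        by (intro bdd_belowI2[of _ "- q0 (- x)"]) simp
      have le: "u x \<le> q x" if "q \<in> C" for q x
        unfolding u_def using that by (intro cINF_lower[OF bdd])
      have sub: "sublinear q" if "q \<in> C" for q
        using CA that by (auto simp: A_def)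
      have "sublinear u"
      proof (rule sublinearI)
        fix x y
        have "u (x + y) - a x \<le> b y" if ab: "a \<in> C" "b \<in> C" for a b
        proof -
          \<comment> \<open>The two infima run over independent members \<open>a\<close> and
            \<open>b\<close>; the smaller of the two gives the mixed estimate.\<close>
          obtain c where c: "c \<in> C" "c \<le> a" "c \<le> b" using cmp[OF ab] ab by blast
          have "u (x + y) \<le> c x + c y"
            using le[OF c(1), of "x + y"] sublinear_add[OF sub[OF c(1)], of x y] by linarith
          also have "\<dots> \<le> a x + b y" by (intro add_mono le_funD[OF c(2)] le_funD[OF c(3)])
          finally show ?thesis by simp
        qed
        then have "u (x + y) - a x \<le> u y" if "a \<in> C" for a
          unfolding u_def[of y] using that False by (intro cINF_greatest) auto
        then have "u (x + y) - u y \<le> a x" if "a \<in> C" for a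
          using that by (simp add: algebra_simps)
        then have "u (x + y) - u y \<le> u x"
          unfolding u_def[of x] using False by (intro cINF_greatest) auto
        then show "u (x + y) \<le> u x + u y" by simp
      next
        fix r :: real and x assume r: "0 < r"
        have "u (r *\<^sub>R x) / r \<le> a x" if "a \<in> C" for a
          using le[OF that, of "r *\<^sub>R x"] sublinear_scale[OF sub[OF that], of r x] r
          by (simp add: field_simps)
        then have "u (r *\<^sub>R x) / r \<le> u x"
          unfolding u_def[of x] using False by (intro cINF_greatest) auto
        then show "u (r *\<^sub>R x) \<le> r * u x" using r by (simp add: field_simps)
      next
        have "u 0 = (INF q\<in>C. 0)"
          unfolding u_def by (intro INF_cong refl sublinear_0[OF sub])
        then show "u 0 = 0" using False by simp
      qed
      moreover have "u \<le> q0"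
      proof -
        obtain a where a: "a \<in> C" using False by auto
        then have "a \<le> q0" using CA by (auto simp: A_def)
        then have "a x \<le> q0 x" for x by (rule le_funD)
        then show ?thesis by (intro le_funI order_trans[OF le[OF a]])
      qed
      moreover have "u \<le> a" if "a \<in> C" for a by (rule le_funI) (rule le[OF that])
      ultimately show ?thesis unfolding A_def by blast
    qed
  qed
  then obtain q where q: "q \<in> A" and min: "\<forall>a\<in>A. a \<le> q \<longrightarrow> a = q" by blast
  show ?thesis
  proof (rule that)
    show "\<forall>q'. sublinear q' \<longrightarrow> q' \<le> q \<longrightarrow> q' = q"
    proof (intro allI impI)
      fix q' assume "sublinear q'" "q' \<le> q"
      moreover have "q' \<le> q0" using \<open>q' \<le> q\<close> q order_trans[of q' q q0] by (simp add: A_def)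
      ultimately show "q' = q" using min by (simp add: A_def)
    qed
  qed (use q in \<open>simp_all add: A_def\<close>)
qed

text \<open>
  Hahn--Banach without subspaces: a minimal sublinear functional is linear, because lowering it
  along a ray changes nothing.
\<close>

lemma Hahn_Banach_sublinear:
  assumes "sublinear q0"
  obtains u where "linear u" "\<And>x. u x \<le> q0 x"
proof -
  obtain q where q: "sublinear q" "q \<le> q0" and min: "\<forall>q'. sublinear q' \<longrightarrow> q' \<le> q \<longrightarrow> q' = q"
    by (rule minimal_sublinear_exists[OF assms])
  have add: "q (x + v) = q x + q v" for x v
  proof -
    define q' where "q' = (\<lambda>x. INF t\<in>{0..}. q (x + t *\<^sub>R v) - t * q v)"
    have ray: "sublinear q'" "\<And>x t. 0 \<le> t \<Longrightarrow> q' x \<le> q (x + t *\<^sub>R v) - t * q v"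
      unfolding q'_def by (fact sublinear_INF_ray[OF q(1) order_refl])+
    have "q' \<le> q" using ray(2)[of 0] by (intro le_funI) simp
    then have "q' = q" by (rule min[rule_format, OF ray(1)])
    then have "q x \<le> q (x + v) - q v" using ray(2)[of 1 x] by simp
    then show ?thesis using sublinear_add[OF q(1), of x v] by simp
  qed
  have neg: "q (- x) = - q x" for x
    using add[of x "- x"] sublinear_0[OF q(1)] by simp
  have "linear q"
  proof (rule linearI[OF add])
    fix r x
    show "q (r *\<^sub>R x) = r *\<^sub>R q x"
    proof (cases "0 \<le> r")
      case False
      then have "q ((- r) *\<^sub>R x) = - r * q x" by (intro sublinear_scale[OF q(1)]) simp
      then show ?thesis using neg[of "r *\<^sub>R x"] by simp
    qed (use sublinear_scale[OF q(1)] in simp)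
  qed
  then show ?thesis using that q(2) by (auto simp: le_fun_def)
qed

text \<open>Lowering the norm along the ray of \<open>y\<close> with the maximal slope
  \<open>norm y\<close> leaves a linear functional below it no choice at \<open>y\<close>: it is at
  most \<open>norm y\<close> there, and at most \<open>- norm y\<close> at
  \<open>- y\<close>.\<close>

lemma norming_functional:
  fixes y :: "'a::real_normed_vector"
  obtains u :: "'a \<Rightarrow>\<^sub>L real" where "norm u \<le> 1" "blinfun_apply u y = norm y"
proof -
  have "sublinear (norm :: 'a \<Rightarrow> real)"
    by (rule sublinearI) (auto simp: norm_triangle_ineq)
  note ray = sublinear_INF_ray[OF this, of "norm y" y, OF order_refl]
  from Hahn_Banach_sublinear[OF ray(1)] obtain u
    where u: "linear u" and le: "\<And>x. u x \<le> (INF t\<in>{0..}. norm (x + t *\<^sub>R y) - t * norm y)"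
    by blast
  interpret u: linear u by (rule u)
  have le_norm: "u x \<le> norm x" for x
    using le[of x] ray(2)[of 0 x] by simp
  have abs: "\<bar>u x\<bar> \<le> norm x" for x
    using le_norm[of x] le_norm[of "- x"] by (simp add: u.neg)
  have "u (- y) \<le> - norm y"
    using le[of "- y"] ray(2)[of 1 "- y"] by simp
  then have "u y = norm y" using le_norm[of y] by (simp add: u.neg)
  moreover have bl: "bounded_linear u"
    using abs by (intro bounded_linear_intro[of _ 1]) (auto simp: u.add u.scale)
  ultimately show ?thesis
    using abs by (intro that[of "Blinfun u"] norm_blinfun_bound) (auto simp: bounded_linear_Blinfun_apply)
qed

subsection \<open>Cotype 2 and 2-summing operators\<close>

abbreviation signs :: "nat \<Rightarrow> (nat \<Rightarrow> real) set" where
  "signs n \<equiv> {..<n} \<rightarrow>\<^sub>E {- 1, 1}"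

lemma finite_signs: "finite (signs n)"
  by (intro finite_PiE) auto

text \<open>Conditioning on the last sign. \<open>F\<close> is arbitrary, so that the second and the
  fourth moments both follow by induction from this recursion.\<close>

lemma sum_signs_Suc:
  fixes v :: "nat \<Rightarrow> 'a::real_vector" and F :: "'a \<Rightarrow> 'b::comm_monoid_add"
  shows "(\<Sum>\<epsilon>\<in>signs (Suc n). F (\<Sum>i<Suc n. \<epsilon> i *\<^sub>R v i)) =
    (\<Sum>\<epsilon>\<in>signs n. F ((\<Sum>i<n. \<epsilon> i *\<^sub>R v i) + v n) + F ((\<Sum>i<n. \<epsilon> i *\<^sub>R v i) - v n))"
proof -
  let ?S = "\<lambda>\<epsilon>. \<Sum>i<n. \<epsilon> i *\<^sub>R v i"
  have inj: "inj_on (\<lambda>(y, g). g(n := y)) ({- 1, 1} \<times> signs n)"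
    by (rule inj_combinator) simp
  have S: "?S (\<epsilon>(n := y)) = ?S \<epsilon>" for \<epsilon> y
    by (intro sum.cong) auto
  have "(\<Sum>\<epsilon>\<in>signs (Suc n). F (\<Sum>i<Suc n. \<epsilon> i *\<^sub>R v i)) =
      (\<Sum>x\<in>{- 1, 1} \<times> signs n. F (?S (snd x) + fst x *\<^sub>R v n))"
    unfolding lessThan_Suc PiE_insert_eq sum.reindex[OF inj] comp_def
  proof (rule sum.cong[OF refl])
    fix x :: "real \<times> (nat \<Rightarrow> real)"
    obtain y \<epsilon> where x: "x = (y, \<epsilon>)" by fastforce
    have "(\<Sum>i\<in>insert n {..<n}. (\<epsilon>(n := y)) i *\<^sub>R v i) = y *\<^sub>R v n + ?S \<epsilon>"
      by simp
    then show "F (\<Sum>i\<in>insert n {..<n}. (case x of (y, g) \<Rightarrow> g(n := y)) i *\<^sub>R v i) = F (?S (snd x) + fst x *\<^sub>R v n)"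
      unfolding x by (simp add: add.commute)
  qed
  also have "\<dots> = (\<Sum>y\<in>{- 1, 1}. \<Sum>\<epsilon>\<in>signs n. F (?S \<epsilon> + y *\<^sub>R v n))"
    unfolding sum.cartesian_product by (simp add: case_prod_beta)
  also have "\<dots> = (\<Sum>\<epsilon>\<in>signs n. F (?S \<epsilon> - v n)) + (\<Sum>\<epsilon>\<in>signs n. F (?S \<epsilon> + v n))"
    by simp
  also have "\<dots> = (\<Sum>\<epsilon>\<in>signs n. F (?S \<epsilon> + v n) + F (?S \<epsilon> - v n))"
    unfolding sum.distrib by (rule add.commute)
  finally show ?thesis .
qed

lemma sum_signs_power2:
  fixes h :: "nat \<Rightarrow> real"
  shows "(\<Sum>\<epsilon>\<in>signs n. (\<Sum>i<n. \<epsilon> i * h i)\<^sup>2) = 2 ^ n * (\<Sum>i<n. (h i)\<^sup>2)"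
proof (induction n)
  case (Suc n)
  have "(\<Sum>\<epsilon>\<in>signs (Suc n). (\<Sum>i<Suc n. \<epsilon> i * h i)\<^sup>2) =
      (\<Sum>\<epsilon>\<in>signs n. 2 * (\<Sum>i<n. \<epsilon> i * h i)\<^sup>2 + 2 * (h n)\<^sup>2)"
    using sum_signs_Suc[where F = "\<lambda>s. s\<^sup>2" and v = h and n = n]
    by (simp add: power2_sum power2_diff)
  also have "\<dots> = 2 ^ Suc n * (\<Sum>i<Suc n. (h i)\<^sup>2)"
    using Suc by (simp add: sum.distrib sum_distrib_left[symmetric] card_PiE algebra_simps)
  finally show ?case .
qed simp

text \<open>The two values of the last sign cancel the odd powers. With the constant 3 the induction
  closes: the mixed term matches that of the expanded square exactly, and the only loss is 1 against
  3 in front of \<open>h n ^ 4\<close>.\<close>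

lemma Khinchine_power4:
  fixes h :: "nat \<Rightarrow> real"
  shows "(\<Sum>\<epsilon>\<in>signs n. (\<Sum>i<n. \<epsilon> i * h i) ^ 4) \<le> 3 * 2 ^ n * (\<Sum>i<n. (h i)\<^sup>2)\<^sup>2"
proof (induction n)
  case (Suc n)
  let ?A = "\<Sum>i<n. (h i)\<^sup>2"
  have pow4: "(s + b) ^ 4 + (s - b) ^ 4 = 2 * s ^ 4 + 12 * b\<^sup>2 * s\<^sup>2 + 2 * b ^ 4" for s b :: real
    by algebra
  have "(\<Sum>\<epsilon>\<in>signs (Suc n). (\<Sum>i<Suc n. \<epsilon> i * h i) ^ 4) =
      (\<Sum>\<epsilon>\<in>signs n. 2 * (\<Sum>i<n. \<epsilon> i * h i) ^ 4 + 12 * (h n)\<^sup>2 * (\<Sum>i<n. \<epsilon> i * h i)\<^sup>2 + 2 * h n ^ 4)"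
    using sum_signs_Suc[where F = "\<lambda>s. s ^ 4" and v = h and n = n]
    by (simp add: pow4)
  also have "\<dots> = 2 * (\<Sum>\<epsilon>\<in>signs n. (\<Sum>i<n. \<epsilon> i * h i) ^ 4) + 12 * (h n)\<^sup>2 * (2 ^ n * ?A) + 2 * 2 ^ n * h n ^ 4"
    by (simp add: sum.distrib sum_distrib_left[symmetric] card_PiE sum_signs_power2)
  also have "\<dots> \<le> 2 * (3 * 2 ^ n * ?A\<^sup>2) + 12 * (h n)\<^sup>2 * (2 ^ n * ?A) + 2 * 2 ^ n * (3 * h n ^ 4)"
    using Suc by (intro add_mono mult_left_mono) auto
  also have "\<dots> = 3 * 2 ^ Suc n * (\<Sum>i<Suc n. (h i)\<^sup>2)\<^sup>2"
    by (simp add: power2_sum algebra_simps power4_eq_xxxx power2_eq_square)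
  finally show ?case .
qed simp

text \<open>
  Maurey's theorem for operators on \<open>\<ell>\<^sub>\<infinity>(J)\<close>, given by the images \<open>v\<^sub>j\<close> of the unit vectors.
  The least admissible \<open>P\<close> in place of \<open>48 C\<^sup>4 M\<^sup>2\<close> is finite.  By cotype, it is bounded in terms
  of the vectors \<open>g\<^sub>\<epsilon> = \<Sum>\<^sub>n \<epsilon>\<^sub>n h\<^sub>n\<close>.  Each of them is split at height \<open>t\<close>: the lower part has image
  of norm at most \<open>M t\<close>, and the fourth moments of the coordinates bound the square sum of the
  upper parts by \<open>3 / t\<^sup>2\<close>, so that \<open>P \<le> C\<^sup>2 (2 M\<^sup>2 t\<^sup>2 + 6 P / t\<^sup>2)\<close>.
\<close>

lemma two_summing_of_cotype_2:
  fixes v :: "'j \<Rightarrow> 'v::real_normed_vector" and h :: "nat \<Rightarrow> 'j \<Rightarrow> real"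
  assumes C: "0 < C"
    and cotype: "\<And>n (w::nat \<Rightarrow> 'v). (\<Sum>i<n. (norm (w i))\<^sup>2) \<le>
      C\<^sup>2 * ((\<Sum>\<epsilon>\<in>signs n. (norm (\<Sum>i<n. \<epsilon> i *\<^sub>R w i))\<^sup>2) / 2 ^ n)"
    and J: "finite J"
    and M: "\<And>t. (\<And>j. j \<in> J \<Longrightarrow> \<bar>t j\<bar> \<le> 1) \<Longrightarrow> norm (\<Sum>j\<in>J. t j *\<^sub>R v j) \<le> M"
    and h: "\<And>j. j \<in> J \<Longrightarrow> (\<Sum>n<m. (h n j)\<^sup>2) \<le> 1"
  shows "(\<Sum>n<m. (norm (\<Sum>j\<in>J. h n j *\<^sub>R v j))\<^sup>2) \<le> 48 * C ^ 4 * M\<^sup>2"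
proof -
  define T where "T g = (\<Sum>j\<in>J. g j *\<^sub>R v j)" for g
  define A where "A = {(m, h :: nat \<Rightarrow> 'j \<Rightarrow> real). \<forall>j\<in>J. (\<Sum>n<m. (h n j)\<^sup>2) \<le> 1}"
  define Q where "Q = (\<lambda>(m :: nat, h). \<Sum>n<m. (norm (T (h n)))\<^sup>2)"
  define P where "P = Sup (Q ` A)"
  \<comment> \<open>This crude bound depends on \<open>J\<close> and the vectors \<open>v j\<close>.
    It serves only to make \<open>P\<close> a genuine supremum, so that \<open>P / 2\<close> can be
    absorbed at the end.\<close>
  have bdd: "bdd_above (Q ` A)"
  proof (rule bdd_aboveI2)
    fix x assume "x \<in> A"
    then obtain m h where x: "x = (m, h)" and h: "\<And>j. j \<in> J \<Longrightarrow> (\<Sum>n<m. (h n j)\<^sup>2) \<le> 1"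
      by (auto simp: A_def)
    have "(norm (T (h n)))\<^sup>2 \<le> (\<Sum>j\<in>J. (h n j)\<^sup>2) * (\<Sum>j\<in>J. (norm (v j))\<^sup>2)" for n
    proof -
      have "norm (T (h n)) \<le> (\<Sum>j\<in>J. \<bar>h n j\<bar> * norm (v j))"
        unfolding T_def by (rule norm_sum[THEN order_trans]) simp
      then have "(norm (T (h n)))\<^sup>2 \<le> (\<Sum>j\<in>J. \<bar>h n j\<bar> * norm (v j))\<^sup>2"
        by (rule power_mono) simp
      also have "\<dots> \<le> (\<Sum>j\<in>J. \<bar>h n j\<bar>\<^sup>2) * (\<Sum>j\<in>J. (norm (v j))\<^sup>2)"
        by (rule Cauchy_Schwarz_ineq_sum)
      finally show ?thesis by simp
    qed
    then have "Q x \<le> (\<Sum>n<m. (\<Sum>j\<in>J. (h n j)\<^sup>2) * (\<Sum>j\<in>J. (norm (v j))\<^sup>2))"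
      unfolding Q_def x by (auto intro: sum_mono)
    also have "\<dots> = (\<Sum>j\<in>J. \<Sum>n<m. (h n j)\<^sup>2) * (\<Sum>j\<in>J. (norm (v j))\<^sup>2)"
      by (simp add: sum_distrib_right[symmetric] sum.swap[of _ J])
    also have "\<dots> \<le> (\<Sum>j\<in>J. 1) * (\<Sum>j\<in>J. (norm (v j))\<^sup>2)"
      by (intro mult_right_mono sum_mono h sum_nonneg) auto
    finally show "Q x \<le> (\<Sum>j\<in>J. 1) * (\<Sum>j\<in>J. (norm (v j))\<^sup>2)" .
  qed
  have upper: "Q x \<le> P" if "x \<in> A" for x
    unfolding P_def using that by (rule cSUP_upper[OF _ bdd])
  \<comment> \<open>Homogeneous form of the definition of \<open>P\<close>, for families indexed by
    sign vectors: these are enumerated and divided by \<open>sqrt c\<close> to give an element of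
    \<open>A\<close>. It is what lets \<open>P\<close> reappear in the estimate of the upper
    parts.\<close>
  have family: "(\<Sum>a\<in>S. (norm (T (g a)))\<^sup>2) \<le> P * c"
    if S: "finite S" and c: "0 < c" and g: "\<And>j. j \<in> J \<Longrightarrow> (\<Sum>a\<in>S. (g a j)\<^sup>2) \<le> c"
    for S :: "(nat \<Rightarrow> real) set" and g c
  proof -
    obtain e where e: "bij_betw e {..<card S} S"
      using ex_bij_betw_nat_finite[OF S] by (auto simp: atLeast0LessThan)
    define h where "h n j = g (e n) j / sqrt c" for n j
    have "(\<Sum>n<card S. (h n j)\<^sup>2) = (\<Sum>a\<in>S. (g a j)\<^sup>2) / c" for j
      unfolding h_def using sum.reindex_bij_betw[OF e, of "\<lambda>a. (g a j)\<^sup>2 / c"] c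
      by (simp add: power_divide sum_divide_distrib)
    then have "(card S, h) \<in> A"
      using g c by (simp add: A_def)
    then have "Q (card S, h) \<le> P" by (rule upper)
    moreover have "T (h n) = (1 / sqrt c) *\<^sub>R T (g (e n))" for n
      by (simp add: T_def h_def scaleR_sum_right)
    then have "Q (card S, h) = (\<Sum>n<card S. (norm (T (g (e n))))\<^sup>2 / c)"
      unfolding Q_def using c by (simp add: power_mult_distrib power_divide)
    also have "\<dots> = (\<Sum>a\<in>S. (norm (T (g a)))\<^sup>2) / c"
      using sum.reindex_bij_betw[OF e, of "\<lambda>a. (norm (T (g a)))\<^sup>2 / c"]
      by (simp add: sum_divide_distrib)
    ultimately show ?thesis using c by (simp add: field_simps)
  qed
  have "Q x \<le> 24 * C ^ 4 * M\<^sup>2 + P / 2" if "x \<in> A" for x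
  proof -
    obtain m h where x: "x = (m, h)" and h: "\<And>j. j \<in> J \<Longrightarrow> (\<Sum>n<m. (h n j)\<^sup>2) \<le> 1"
      using \<open>x \<in> A\<close> by (auto simp: A_def)
    \<comment> \<open>With this height the factor \<open>6 * C\<^sup>2 / t\<^sup>2\<close> in front
      of \<open>P\<close> becomes 1/2, and \<open>2 * C\<^sup>2 * M\<^sup>2 * t\<^sup>2\<close>
      becomes \<open>24 * C ^ 4 * M\<^sup>2\<close>.\<close>
    define t where "t = sqrt (12 * C\<^sup>2)"
    have t: "0 < t" and t2: "t\<^sup>2 = 12 * C\<^sup>2" using C by (auto simp: t_def)
    define g where "g \<epsilon> j = (\<Sum>n<m. \<epsilon> n * h n j)" for \<epsilon> :: "nat \<Rightarrow> real" and j
    define lo where "lo \<epsilon> j = (if \<bar>g \<epsilon> j\<bar> \<le> t then g \<epsilon> j else 0)" for \<epsilon> j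
    define up where "up \<epsilon> j = (if \<bar>g \<epsilon> j\<bar> \<le> t then 0 else g \<epsilon> j)" for \<epsilon> j
    have T_split: "T (g \<epsilon>) = T (lo \<epsilon>) + T (up \<epsilon>)" for \<epsilon>
      unfolding T_def sum.distrib[symmetric] by (intro sum.cong) (auto simp: lo_def up_def)
    have T_lo: "norm (T (lo \<epsilon>)) \<le> M * t" for \<epsilon>
    proof -
      have "norm (\<Sum>j\<in>J. (lo \<epsilon> j / t) *\<^sub>R v j) \<le> M"
        using t by (intro M) (auto simp: lo_def)
      moreover have "(\<Sum>j\<in>J. (lo \<epsilon> j / t) *\<^sub>R v j) = (1 / t) *\<^sub>R T (lo \<epsilon>)"
        by (simp add: T_def scaleR_sum_right)
      ultimately show ?thesis using t by (simp add: field_simps)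
    qed
    have up4: "(up \<epsilon> j)\<^sup>2 \<le> g \<epsilon> j ^ 4 / t\<^sup>2" for \<epsilon> j
    proof (cases "\<bar>g \<epsilon> j\<bar> \<le> t")
      case False
      then have "t\<^sup>2 \<le> (g \<epsilon> j)\<^sup>2" using t by (simp add: abs_le_square_iff[symmetric])
      then have "t\<^sup>2 * (g \<epsilon> j)\<^sup>2 \<le> (g \<epsilon> j)\<^sup>2 * (g \<epsilon> j)\<^sup>2" by (rule mult_right_mono) simp
      then show ?thesis using t False
        by (simp add: up_def field_simps power4_eq_xxxx power2_eq_square)
    qed (simp add: up_def)
    have "(\<Sum>\<epsilon>\<in>signs m. (up \<epsilon> j)\<^sup>2) \<le> 3 * 2 ^ m / t\<^sup>2" if "j \<in> J" for j
    proof -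
      have "(\<Sum>\<epsilon>\<in>signs m. (up \<epsilon> j)\<^sup>2) \<le> (\<Sum>\<epsilon>\<in>signs m. g \<epsilon> j ^ 4) / t\<^sup>2"
        unfolding sum_divide_distrib by (intro sum_mono up4)
      also have "\<dots> \<le> 3 * 2 ^ m * (\<Sum>n<m. (h n j)\<^sup>2)\<^sup>2 / t\<^sup>2"
        unfolding g_def by (intro divide_right_mono Khinchine_power4) simp
      also have "\<dots> \<le> 3 * 2 ^ m * 1 / t\<^sup>2"
        using h[OF that] by (intro divide_right_mono mult_left_mono power_le_one) (auto intro: sum_nonneg)
      finally show ?thesis by simp
    qed
    then have T_up: "(\<Sum>\<epsilon>\<in>signs m. (norm (T (up \<epsilon>)))\<^sup>2) \<le> P * (3 * 2 ^ m / t\<^sup>2)"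
      using t by (intro family finite_signs) auto
    have sq: "(norm (T (g \<epsilon>)))\<^sup>2 \<le> 2 * (M * t)\<^sup>2 + 2 * (norm (T (up \<epsilon>)))\<^sup>2" for \<epsilon>
    proof -
      have "norm (T (g \<epsilon>)) \<le> M * t + norm (T (up \<epsilon>))"
        using T_lo[of \<epsilon>] norm_triangle_ineq[of "T (lo \<epsilon>)" "T (up \<epsilon>)"] by (simp add: T_split)
      then have "(norm (T (g \<epsilon>)))\<^sup>2 \<le> (M * t + norm (T (up \<epsilon>)))\<^sup>2" by (rule power_mono) simp
      also have "\<dots> \<le> 2 * (M * t)\<^sup>2 + 2 * (norm (T (up \<epsilon>)))\<^sup>2"
        using sum_squares_bound[of "M * t" "norm (T (up \<epsilon>))"] by (simp add: power2_sum)
      finally show ?thesis .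
    qed
    have T_g: "(\<Sum>n<m. \<epsilon> n *\<^sub>R T (h n)) = T (g \<epsilon>)" for \<epsilon>
      by (simp add: T_def g_def scaleR_sum_right scaleR_sum_left sum.swap[of _ J])
    have "Q x \<le> C\<^sup>2 * ((\<Sum>\<epsilon>\<in>signs m. (norm (T (g \<epsilon>)))\<^sup>2) / 2 ^ m)"
      using cotype[of "\<lambda>n. T (h n)" m] by (simp add: x Q_def T_g)
    also have "\<dots> \<le> C\<^sup>2 * ((\<Sum>\<epsilon>\<in>signs m. 2 * (M * t)\<^sup>2 + 2 * (norm (T (up \<epsilon>)))\<^sup>2) / 2 ^ m)"
      by (intro mult_left_mono divide_right_mono sum_mono sq) auto
    also have "\<dots> = C\<^sup>2 * (2 * (M * t)\<^sup>2 + 2 * (\<Sum>\<epsilon>\<in>signs m. (norm (T (up \<epsilon>)))\<^sup>2) / 2 ^ m)"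
      by (simp add: sum.distrib sum_distrib_left[symmetric] card_PiE add_divide_distrib)
    also have "\<dots> \<le> C\<^sup>2 * (2 * (M * t)\<^sup>2 + 2 * (P * (3 * 2 ^ m / t\<^sup>2)) / 2 ^ m)"
      by (intro mult_left_mono add_left_mono divide_right_mono T_up) auto
    also have "\<dots> = 24 * C ^ 4 * M\<^sup>2 + P / 2"
      using C unfolding power_mult_distrib t2
      by (simp add: field_simps power4_eq_xxxx)
    finally show ?thesis .
  qed
  moreover have "A \<noteq> {}" by (auto simp: A_def intro!: exI[of _ 0])
  ultimately have "P \<le> 24 * C ^ 4 * M\<^sup>2 + P / 2"
    unfolding P_def by (intro cSUP_least) auto
  moreover have "Q (m, h) \<le> P" using h by (intro upper) (simp add: A_def)
  ultimately show ?thesis by (simp add: Q_def T_def)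
qed

subsection \<open>Real and complex scalars\<close>

text \<open>The class provides the norm formula for some representation of each scalar, here it
  holds for every one. The coordinates are unique: if a real number r equals s times
  \<open>i\<close> with s real, squaring gives \<open>r\<^sup>2 + s\<^sup>2 = 0\<close>.\<close>

lemma real_or_complex_cases:
  obtains (real) "\<And>z::'k::real_or_complex. \<exists>a. z = of_real a"
  | (complex) i :: "'k::real_or_complex" where "i * i = - 1" "norm i = 1"
      "\<And>z. \<exists>a b. z = of_real a + of_real b * i"
      "\<And>a b. norm (of_real a + of_real b * i) = sqrt (a\<^sup>2 + b\<^sup>2)"
  using real_or_complex[where 'a='k]
proof (elim disjE exE conjE)
  assume "\<forall>z::'k. \<exists>a. z = a *\<^sub>R 1"
  then show ?thesis by (intro that(1)) (simp add: scaleR_conv_of_real)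
next
  fix i :: 'k
  assume i: "i * i = - 1"
    and rep: "\<forall>z. \<exists>a b. z = a *\<^sub>R 1 + b *\<^sub>R i \<and> norm z = sqrt (a\<^sup>2 + b\<^sup>2)"
  have "norm i * norm i = 1" using i by (metis norm_minus_cancel norm_mult norm_one)
  then have norm_i: "norm i = 1" by (metis abs_norm_cancel abs_square_eq_1 power2_eq_square)
  have rep': "\<exists>a b. z = of_real a + of_real b * i \<and> norm z = sqrt (a\<^sup>2 + b\<^sup>2)" for z
    using rep[rule_format, of z] by (simp add: scaleR_conv_of_real)
  have "norm (of_real a + of_real b * i) = sqrt (a\<^sup>2 + b\<^sup>2)" for a b
  proof -
    obtain a' b' where eq: "of_real a + of_real b * i = of_real a' + of_real b' * i"
      and norm: "norm (of_real a + of_real b * i) = sqrt (a'\<^sup>2 + b'\<^sup>2)"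
      using rep' by blast
    from eq have "of_real (a - a') = of_real (b' - b) * i"
      by (simp add: algebra_simps)
    then have "of_real (a - a') * of_real (a - a') = (of_real (b' - b) * i) * (of_real (b' - b) * i)"
      by simp
    also have "\<dots> = of_real (b' - b) * of_real (b' - b) * (i * i)"
      by (simp only: ac_simps)
    finally have "(of_real ((a - a')\<^sup>2 + (b' - b)\<^sup>2) :: 'k) = 0"
      by (simp add: i power2_eq_square)
    then have "(a - a')\<^sup>2 + (b' - b)\<^sup>2 = 0" by (simp only: of_real_eq_0_iff)
    then have "a = a'" "b = b'" by (auto simp: sum_power2_eq_zero_iff)
    with norm show ?thesis by simp
  qed
  with i norm_i rep' show ?thesis by (intro that(2)) blast+
qed

text \<open>Choosing \<open>j = 0\<close> for real scalars lets later estimates treat both fields by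
  the same splitting into two real parts.\<close>

lemma real_imag_parts:
  obtains j :: "'k::real_or_complex"
  where "norm j \<le> 1" "\<forall>z. \<exists>a b. z = of_real a + of_real b * j \<and> \<bar>a\<bar> \<le> norm z \<and> \<bar>b\<bar> \<le> norm z"
proof (cases rule: real_or_complex_cases[where 'k='k])
  case real
  show ?thesis
  proof (rule that[of 0])
    show "\<forall>z::'k. \<exists>a b. z = of_real a + of_real b * 0 \<and> \<bar>a\<bar> \<le> norm z \<and> \<bar>b\<bar> \<le> norm z"
    proof
      fix z :: 'k
      obtain a where "z = of_real a" using real by blast
      then show "\<exists>a b. z = of_real a + of_real b * 0 \<and> \<bar>a\<bar> \<le> norm z \<and> \<bar>b\<bar> \<le> norm z"
        by (intro exI[of _ a] exI[of _ 0]) simp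
    qed
  qed simp
next
  case (complex i)
  show ?thesis
  proof (rule that[of i])
    show "\<forall>z. \<exists>a b. z = of_real a + of_real b * i \<and> \<bar>a\<bar> \<le> norm z \<and> \<bar>b\<bar> \<le> norm z"
    proof
      fix z
      obtain a b where "z = of_real a + of_real b * i" using complex(3) by blast
      then show "\<exists>a b. z = of_real a + of_real b * i \<and> \<bar>a\<bar> \<le> norm z \<and> \<bar>b\<bar> \<le> norm z"
        using complex(4)[of a b] by (intro exI[of _ a] exI[of _ b]) (simp add: real_sqrt_ge_abs1 real_sqrt_ge_abs2)
    qed
  qed (use complex in simp)
qed

text \<open>The ball is a closed subset of the continuous image of a compact square of real
  coordinates.\<close>

lemma compact_cball_scalars: "compact (cball (0::'k::real_or_complex) r)"
proof -
  obtain j :: 'k where j: "norm j \<le> 1"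
    "\<forall>z. \<exists>a b. z = of_real a + of_real b * j \<and> \<bar>a\<bar> \<le> norm z \<and> \<bar>b\<bar> \<le> norm z"
    by (rule real_imag_parts)
  let ?f = "\<lambda>(a, b). of_real a + of_real b * j"
  have "compact (?f ` (cball 0 r \<times> cball 0 r))"
    unfolding case_prod_beta
    by (intro compact_continuous_image compact_Times compact_cball continuous_intros)
  moreover have "cball 0 r \<subseteq> ?f ` (cball 0 r \<times> cball 0 r)"
  proof
    fix z :: 'k assume z: "z \<in> cball 0 r"
    obtain a b where "z = of_real a + of_real b * j" "\<bar>a\<bar> \<le> norm z" "\<bar>b\<bar> \<le> norm z"
      using j(2) by blast
    with z show "z \<in> ?f ` (cball 0 r \<times> cball 0 r)"
      by (intro image_eqI[of _ _ "(a, b)"]) auto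
  qed
  ultimately show ?thesis
    by (metis Int_absorb1 closed_cball compact_Int_closed)
qed

context normed_over
begin

lemma scale_of_real_add: "scale (of_real a + of_real b * j) x = a *\<^sub>R x + b *\<^sub>R scale j x"
  by (simp only: scale_left_distrib scale_of_real flip: scale_scale)

lemma dual_spaceI:
  fixes v :: "'a \<Rightarrow>\<^sub>L 'k"
  assumes "\<And>c x. v (scale c x) = c * v x"
  shows "v \<in> dual_space scale"
proof -
  have "Vector_Spaces.linear scale (*) v"
    by unfold_locales (simp_all add: assms blinfun.add_right algebra_simps)
  then show ?thesis by (simp add: dual_space_def operators_def)
qed

text \<open>The real dual embeds into the dual over the scalars by \<open>v \<mapsto> (x \<mapsto> v(x) - i v(ix))\<close>.\<close>

lemma real_functionals_embed:
  obtains \<Phi> :: "('a \<Rightarrow>\<^sub>L real) \<Rightarrow> ('a \<Rightarrow>\<^sub>L 'k)"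
  where "linear \<Phi>" "\<forall>v. \<Phi> v \<in> dual_space scale"
    "\<forall>v. norm v \<le> norm (\<Phi> v)" "\<forall>v. norm (\<Phi> v) \<le> 2 * norm v"
proof -
  have "\<exists>\<Phi> :: ('a \<Rightarrow>\<^sub>L real) \<Rightarrow> ('a \<Rightarrow>\<^sub>L 'k). linear \<Phi> \<and> (\<forall>v. \<Phi> v \<in> dual_space scale) \<and>
    (\<forall>v x. \<bar>blinfun_apply v x\<bar> \<le> norm (blinfun_apply (\<Phi> v) x) \<and>
      norm (blinfun_apply (\<Phi> v) x) \<le> 2 * norm v * norm x)"
  proof (cases rule: real_or_complex_cases[where 'k='k])
    case real
    define \<Phi> :: "('a \<Rightarrow>\<^sub>L real) \<Rightarrow> ('a \<Rightarrow>\<^sub>L 'k)" where "\<Phi> v = Blinfun (\<lambda>x. of_real (v x))" for v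
    have \<Phi>: "blinfun_apply (\<Phi> v) x = of_real (v x)" for v :: "'a \<Rightarrow>\<^sub>L real" and x
      unfolding \<Phi>_def
      by (subst bounded_linear_Blinfun_apply)
        (auto intro!: bounded_linear_compose[OF bounded_linear_of_real] blinfun.bounded_linear_right)
    have "linear \<Phi>"
      by (rule linearI)
        (auto intro!: blinfun_eqI simp: \<Phi> blinfun.add_left blinfun.scaleR_left scaleR_conv_of_real)
    moreover have "\<Phi> v \<in> dual_space scale" for v
    proof (rule dual_spaceI)
      fix c :: 'k and x
      obtain a where "c = of_real a" using real by blast
      then show "\<Phi> v (scale c x) = c * \<Phi> v x"
        by (simp add: \<Phi> scale_of_real blinfun.scaleR_right scaleR_conv_of_real)
    qed
    moreover have "norm (\<Phi> v x) \<le> 2 * norm v * norm x" for v :: "'a \<Rightarrow>\<^sub>L real" and x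
      using norm_blinfun[of v x] by (simp add: \<Phi>)
    ultimately show ?thesis by (intro exI[of _ \<Phi>]) (simp add: \<Phi>)
  next
    case (complex i)
    define \<Phi> :: "('a \<Rightarrow>\<^sub>L real) \<Rightarrow> ('a \<Rightarrow>\<^sub>L 'k)"
      where "\<Phi> v = Blinfun (\<lambda>x. of_real (v x) + of_real (- v (scale i x)) * i)" for v
    have \<Phi>: "blinfun_apply (\<Phi> v) x = of_real (v x) + of_real (- v (scale i x)) * i" for v :: "'a \<Rightarrow>\<^sub>L real" and x
      unfolding \<Phi>_def
      by (subst bounded_linear_Blinfun_apply)
        (auto intro!: bounded_linear_compose[OF bounded_linear_of_real] blinfun.bounded_linear_right
          bounded_linear_sub bounded_linear_mult_const
          bounded_linear_compose[OF blinfun.bounded_linear_right bounded_linear_scale])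
    have lin: "\<Phi> (v + w) = \<Phi> v + \<Phi> w" "\<Phi> (r *\<^sub>R v) = r *\<^sub>R \<Phi> v" for v w r
      by (auto intro!: blinfun_eqI simp: \<Phi> blinfun.add_left blinfun.scaleR_left
        scaleR_conv_of_real algebra_simps)
    have "linear \<Phi>" by (rule linearI) (rule lin)+
    moreover have "\<Phi> v \<in> dual_space scale" for v
    proof -
      have sc: "\<Phi> v (scale c x) = c * \<Phi> v x" for c x
      proof -
        obtain a b where c: "c = of_real a + of_real b * i" using complex(3) by blast
        have ii: "scale (i * i) x = - x"
          using complex(1) by simp
        have ic: "scale i (scale c x) = a *\<^sub>R scale i x - b *\<^sub>R x"
          unfolding c scale_of_real_add
          by (simp add: scale_right_distrib ii linear_cmul[OF bounded_linear.linear[OF bounded_linear_scale]])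
        have i2: "i * (i * z) = - z" for z using complex(1) by (simp flip: mult.assoc)
        show ?thesis
          unfolding \<Phi> ic unfolding c scale_of_real_add
          by (simp add: blinfun.add_right blinfun.diff_right blinfun.scaleR_right algebra_simps i2 complex(1))
      qed
      then show ?thesis by (rule dual_spaceI)
    qed
    moreover have "\<bar>v x\<bar> \<le> norm (\<Phi> v x)" for v :: "'a \<Rightarrow>\<^sub>L real" and x
      unfolding \<Phi> complex(4) by (rule real_sqrt_ge_abs1)
    moreover have "norm (\<Phi> v x) \<le> 2 * norm v * norm x" for v :: "'a \<Rightarrow>\<^sub>L real" and x
    proof -
      have "norm (\<Phi> v x) \<le> \<bar>v x\<bar> + \<bar>v (scale i x)\<bar>"
        unfolding \<Phi> by (rule norm_triangle_le) (simp add: norm_mult complex(2))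
      also have "\<dots> \<le> norm v * norm x + norm v * norm (scale i x)"
        using norm_blinfun[of v x] norm_blinfun[of v "scale i x"] by simp
      finally show ?thesis by (simp add: norm_scale complex(2) mult.commute)
    qed
    ultimately show ?thesis by blast
  qed
  then obtain \<Phi> :: "('a \<Rightarrow>\<^sub>L real) \<Rightarrow> ('a \<Rightarrow>\<^sub>L 'k)" where \<Phi>: "linear \<Phi>" "\<And>v. \<Phi> v \<in> dual_space scale"
    "\<And>v x. \<bar>blinfun_apply v x\<bar> \<le> norm (blinfun_apply (\<Phi> v) x)"
    "\<And>v x. norm (blinfun_apply (\<Phi> v) x) \<le> 2 * norm v * norm x" by blast
  have "norm v \<le> norm (\<Phi> v)" for v
  proof (rule norm_blinfun_bound)
    show "norm (v x) \<le> norm (\<Phi> v) * norm x" for x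
      using \<Phi>(3)[of v x] norm_blinfun[of "\<Phi> v" x] by simp
  qed simp
  moreover have "norm (\<Phi> v) \<le> 2 * norm v" for v
    using \<Phi>(4) by (intro norm_blinfun_bound) auto
  ultimately show ?thesis using \<Phi>(1,2) by (intro that) auto
qed

text \<open>The functionals that occur later are compositions of real functionals on the target
  space with real-linear operators on \<open>'a\<close>, whereas the hypothesis concerns functionals
  linear over the scalars. The embedding preserves sums with real signs and changes norms by a
  factor between 1 and 2, so cotype passes to the real dual.\<close>

lemma cotype_2_real_functionals:
  assumes "has_cotype 2 (dual_space scale)"
  obtains C where "0 < C"
    "\<And>n (w::nat \<Rightarrow> 'a \<Rightarrow>\<^sub>L real). (\<Sum>i<n. (norm (w i))\<^sup>2) \<le>
      C\<^sup>2 * ((\<Sum>\<epsilon>\<in>signs n. (norm (\<Sum>i<n. \<epsilon> i *\<^sub>R w i))\<^sup>2) / 2 ^ n)"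
proof -
  obtain \<Phi> :: "('a \<Rightarrow>\<^sub>L real) \<Rightarrow> ('a \<Rightarrow>\<^sub>L 'k)" where \<Phi>: "linear \<Phi>" "\<forall>v. \<Phi> v \<in> dual_space scale"
    "\<forall>v. norm v \<le> norm (\<Phi> v)" "\<forall>v. norm (\<Phi> v) \<le> 2 * norm v"
    by (rule real_functionals_embed)
  obtain D where D: "\<And>n (v::nat \<Rightarrow> 'a \<Rightarrow>\<^sub>L 'k). (\<forall>i<n. v i \<in> dual_space scale) \<Longrightarrow>
      (\<Sum>i<n. norm (v i) powr 2) powr (1 / 2) \<le>
        D * sqrt ((\<Sum>\<epsilon>\<in>signs n. (norm (\<Sum>i<n. \<epsilon> i *\<^sub>R v i))\<^sup>2) / 2 ^ n)"
    using assms unfolding has_cotype_def by blast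
  \<comment> \<open>The factor 2 comes from \<open>norm (\<Phi> v) \<le> 2 * norm v\<close>; the
    summand 1 makes the constant positive whatever the sign of \<open>D\<close>.\<close>
  define C where "C = 2 * (\<bar>D\<bar> + 1)"
  show ?thesis
  proof (rule that[of C])
    fix n and w :: "nat \<Rightarrow> 'a \<Rightarrow>\<^sub>L real"
    let ?E = "(\<Sum>\<epsilon>\<in>signs n. (norm (\<Sum>i<n. \<epsilon> i *\<^sub>R \<Phi> (w i)))\<^sup>2) / 2 ^ n"
    let ?e = "(\<Sum>\<epsilon>\<in>signs n. (norm (\<Sum>i<n. \<epsilon> i *\<^sub>R w i))\<^sup>2) / 2 ^ n"
    have E0: "0 \<le> ?E" by (intro divide_nonneg_nonneg sum_nonneg) auto
    have "sqrt (\<Sum>i<n. (norm (\<Phi> (w i)))\<^sup>2) \<le> D * sqrt ?E"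
      using D[of n "\<lambda>i. \<Phi> (w i)"] \<Phi>(2) by (simp add: powr_half_sqrt sum_nonneg)
    also have "\<dots> \<le> (\<bar>D\<bar> + 1) * sqrt ?E" using E0 by (intro mult_right_mono) auto
    finally have "(sqrt (\<Sum>i<n. (norm (\<Phi> (w i)))\<^sup>2))\<^sup>2 \<le> ((\<bar>D\<bar> + 1) * sqrt ?E)\<^sup>2"
      by (rule power_mono) (simp add: sum_nonneg)
    then have "(\<Sum>i<n. (norm (\<Phi> (w i)))\<^sup>2) \<le> (\<bar>D\<bar> + 1)\<^sup>2 * ?E"
      using E0 by (simp add: sum_nonneg power_mult_distrib)
    moreover have "(\<Sum>i<n. (norm (w i))\<^sup>2) \<le> (\<Sum>i<n. (norm (\<Phi> (w i)))\<^sup>2)"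
      using \<Phi>(3) by (intro sum_mono power_mono) auto
    moreover have "?E \<le> 4 * ?e"
    proof -
      have "(norm (\<Sum>i<n. \<epsilon> i *\<^sub>R \<Phi> (w i)))\<^sup>2 \<le> 4 * (norm (\<Sum>i<n. \<epsilon> i *\<^sub>R w i))\<^sup>2" for \<epsilon>
      proof -
        have "(\<Sum>i<n. \<epsilon> i *\<^sub>R \<Phi> (w i)) = \<Phi> (\<Sum>i<n. \<epsilon> i *\<^sub>R w i)"
          by (simp add: linear_sum[OF \<Phi>(1)] linear_cmul[OF \<Phi>(1)])
        then have "(norm (\<Sum>i<n. \<epsilon> i *\<^sub>R \<Phi> (w i)))\<^sup>2 \<le> (2 * norm (\<Sum>i<n. \<epsilon> i *\<^sub>R w i))\<^sup>2"
          using \<Phi>(4) by (intro power_mono) auto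
        then show ?thesis by (simp add: power_mult_distrib)
      qed
      then show ?thesis
        by (simp add: sum_distrib_left divide_right_mono sum_mono)
    qed
    then have "(\<bar>D\<bar> + 1)\<^sup>2 * ?E \<le> (\<bar>D\<bar> + 1)\<^sup>2 * (4 * ?e)" by (rule mult_left_mono) simp
    moreover have "C\<^sup>2 * ?e = (\<bar>D\<bar> + 1)\<^sup>2 * (4 * ?e)"
      unfolding C_def power_mult_distrib by simp
    ultimately show "(\<Sum>i<n. (norm (w i))\<^sup>2) \<le> C\<^sup>2 * ?e"
      by linarith
  qed (simp add: C_def add_nonneg_pos)
qed

end

subsection \<open>The unit ball of the conjugate sequence space\<close>

lemma powr_le_1_iff:
  fixes a r :: real
  assumes "0 \<le> a" "0 < r"
  shows "a powr r \<le> 1 \<longleftrightarrow> a \<le> 1"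
  using assms powr_le1[of r a] gr_one_powr[of a r] by fastforce

lemma lp_ball_infinity: "\<alpha> \<in> lp_ball \<infinity> \<longleftrightarrow> (\<forall>n. norm (\<alpha> n) \<le> 1)"
proof
  assume "\<alpha> \<in> lp_ball \<infinity>"
  then have bdd: "bdd_above (range (\<lambda>n. norm (\<alpha> n)))" and le: "(SUP n. norm (\<alpha> n)) \<le> 1"
    by (auto simp: lp_ball_def in_lp_def lp_norm_def bounded_iff bdd_above_def)
  show "\<forall>n. norm (\<alpha> n) \<le> 1"
    using cSUP_upper[OF UNIV_I bdd] le by (blast intro: order_trans)
next
  assume "\<forall>n. norm (\<alpha> n) \<le> 1"
  then show "\<alpha> \<in> lp_ball \<infinity>"
    by (auto simp: lp_ball_def in_lp_def lp_norm_def bounded_iff intro!: cSUP_least)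
qed

lemma lp_ball_real:
  assumes "0 < q"
  shows "\<alpha> \<in> lp_ball (ereal q) \<longleftrightarrow> (\<forall>m. (\<Sum>n<m. norm (\<alpha> n) powr q) \<le> 1)"
proof -
  let ?f = "\<lambda>n. norm (\<alpha> n) powr q"
  have "\<alpha> \<in> lp_ball (ereal q) \<longleftrightarrow> summable ?f \<and> suminf ?f \<le> 1"
  proof -
    have "suminf ?f powr (1 / q) \<le> 1 \<longleftrightarrow> suminf ?f \<le> 1" if "summable ?f"
      using assms by (intro powr_le_1_iff suminf_nonneg that) auto
    then show ?thesis by (auto simp: lp_ball_def in_lp_def lp_norm_def)
  qed
  also have "\<dots> \<longleftrightarrow> (\<forall>m. sum ?f {..<m} \<le> 1)"
  proof
    assume *: "summable ?f \<and> suminf ?f \<le> 1"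
    show "\<forall>m. sum ?f {..<m} \<le> 1"
    proof
      fix m
      have "sum ?f {..<m} \<le> suminf ?f" using * by (intro sum_le_suminf) auto
      with * show "sum ?f {..<m} \<le> 1" by simp
    qed
  next
    assume *: "\<forall>m. sum ?f {..<m} \<le> 1"
    then have "summable ?f" by (intro summableI_nonneg_bounded) auto
    then show "summable ?f \<and> suminf ?f \<le> 1"
      using * by (auto intro: suminf_le_const)
  qed
  finally show ?thesis .
qed

text \<open>For \<open>p = 1\<close> the conjugate index is infinite. In both cases the ball is cut
  out by conditions on finitely many coordinates each, a form suited to finite sums and to
  coordinatewise limits alike.\<close>

lemma lp_ball_conj_cases:
  assumes "1 \<le> p"
  obtains (one) "p = 1" "\<forall>\<alpha> :: nat \<Rightarrow> 'a::real_normed_vector.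
      \<alpha> \<in> lp_ball (conj_index (ereal p)) \<longleftrightarrow> (\<forall>n. norm (\<alpha> n) \<le> 1)"
  | (gt) q where "1 < p" "1 < q" "1 / p + 1 / q = 1" "\<forall>\<alpha> :: nat \<Rightarrow> 'a::real_normed_vector.
      \<alpha> \<in> lp_ball (conj_index (ereal p)) \<longleftrightarrow> (\<forall>m. (\<Sum>n<m. norm (\<alpha> n) powr q) \<le> 1)"
proof (cases "p = 1")
  case True
  then show ?thesis using lp_ball_infinity conj_index_1 by (intro one) (auto simp: one_ereal_def)
next
  case False
  with assms have p: "1 < p" by simp
  show ?thesis
  proof (rule gt[of "p / (p - 1)"])
    show "\<forall>\<alpha> :: nat \<Rightarrow> 'a. \<alpha> \<in> lp_ball (conj_index (ereal p)) \<longleftrightarrow>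
        (\<forall>m. (\<Sum>n<m. norm (\<alpha> n) powr (p / (p - 1))) \<le> 1)"
      unfolding conj_index_real[OF p] using p by (intro allI lp_ball_real) simp
  qed (use p in \<open>auto simp: field_simps\<close>)
qed

lemma norm_le_1_of_lp_ball:
  fixes \<alpha> :: "nat \<Rightarrow> 'a::real_normed_vector"
  assumes "1 \<le> p" and \<alpha>: "\<alpha> \<in> lp_ball (conj_index (ereal p))"
  shows "norm (\<alpha> n) \<le> 1"
proof (cases rule: lp_ball_conj_cases[OF assms(1), where 'a='a, case_names one gt])
  case one
  then show ?thesis using \<alpha> by blast
next
  case (gt q)
  have "norm (\<alpha> n) powr q \<le> (\<Sum>n<Suc n. norm (\<alpha> n) powr q)"
    by (simp add: sum_nonneg)
  also have "\<dots> \<le> 1" using gt(4) \<alpha> by blast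
  finally show ?thesis using gt(2) by (subst (asm) powr_le_1_iff) auto
qed

lemma Holder_lp_ball_unit:
  fixes \<alpha> :: "nat \<Rightarrow> 'a::real_normed_vector"
  assumes "1 \<le> p" and \<alpha>: "\<alpha> \<in> lp_ball (conj_index (ereal p))"
    and s: "\<And>n. 0 \<le> s n" "(\<Sum>n<m. s n powr p) \<le> 1"
  shows "(\<Sum>n<m. norm (\<alpha> n) * s n) \<le> 1"
proof (cases rule: lp_ball_conj_cases[OF assms(1), where 'a='a, case_names one gt])
  case one
  have "(\<Sum>n<m. norm (\<alpha> n) * s n) \<le> (\<Sum>n<m. s n powr p)"
    using one \<alpha> s(1) by (intro sum_mono) (simp add: mult_left_le_one_le)
  with s(2) show ?thesis by simp
next
  case (gt q)
  have "(\<Sum>n<m. norm (\<alpha> n) * s n) \<le> (\<Sum>n<m. norm (\<alpha> n) powr q / q + s n powr p / p)"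
    using gt s(1) by (intro sum_mono Youngs_inequality) (auto simp: add.commute)
  also have "\<dots> = (\<Sum>n<m. norm (\<alpha> n) powr q) / q + (\<Sum>n<m. s n powr p) / p"
    by (simp add: sum.distrib sum_divide_distrib)
  also have "\<dots> \<le> 1 / q + 1 / p"
    using gt s(2) \<alpha> by (intro add_mono divide_right_mono) auto
  finally show ?thesis using gt(3) by simp
qed

text \<open>
  The exponents \<open>p / (2 - p)\<close> and \<open>p' / 2\<close> are conjugate, so this is again Young's inequality.
\<close>

lemma weighted_square_sum_lp_ball:
  fixes \<alpha> :: "nat \<Rightarrow> 'a::real_normed_vector"
  assumes "1 \<le> p" "p \<le> 2" and \<alpha>: "\<alpha> \<in> lp_ball (conj_index (ereal p))"
    and s: "\<And>n. 0 \<le> s n" "(\<Sum>n<m. s n powr p) \<le> 1"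
  shows "(\<Sum>n<m. (s n powr (1 - p / 2) * norm (\<alpha> n))\<^sup>2) \<le> 1"
proof (cases rule: lp_ball_conj_cases[OF assms(1), where 'a='a, case_names one gt])
  case one
  have "(s n powr (1 - p / 2) * norm (\<alpha> n))\<^sup>2 \<le> s n powr p" for n
  proof -
    have "(s n powr (1 - p / 2))\<^sup>2 = s n powr p"
      using one(1) by (simp add: power2_eq_square flip: powr_add)
    moreover have "(norm (\<alpha> n))\<^sup>2 \<le> 1"
      using one(2) \<alpha> by (simp add: power_le_one)
    ultimately show ?thesis by (simp add: power_mult_distrib mult_left_le)
  qed
  then have "(\<Sum>n<m. (s n powr (1 - p / 2) * norm (\<alpha> n))\<^sup>2) \<le> (\<Sum>n<m. s n powr p)"
    by (rule sum_mono)
  with s(2) show ?thesis by simp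
next
  case (gt q)
  have eq: "(2 - p) / p + 2 / q = 1" using gt(1-3) by (simp add: field_simps)
  have young: "(s n powr (1 - p / 2) * norm (\<alpha> n))\<^sup>2
      \<le> (2 - p) / p * s n powr p + 2 / q * norm (\<alpha> n) powr q" for n
  \<comment> \<open>Zero entries are set apart because for \<open>p = 2\<close> the exponent of the
    first factor vanishes and \<open>0 powr 0 = 0\<close>; otherwise both bases are
    positive.\<close>
  proof (cases "s n = 0 \<or> \<alpha> n = 0")
    case True
    then have "(s n powr (1 - p / 2) * norm (\<alpha> n))\<^sup>2 = 0" by auto
    then show ?thesis using gt(1,2) assms(2) by (simp only:) simp
  next
    case False
    then have "0 < s n" "0 < norm (\<alpha> n)" using s(1)[of n] by auto
    then have "(s n powr p) powr ((2 - p) / p) * (norm (\<alpha> n) powr q) powr (2 / q)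
        \<le> (2 - p) / p * s n powr p + 2 / q * norm (\<alpha> n) powr q"
      using gt(1,2) assms(2) eq by (intro Youngs_inequality_0) auto
    also have "(s n powr p) powr ((2 - p) / p) = (s n powr (1 - p / 2))\<^sup>2"
      using gt(1) by (simp add: powr_powr power2_eq_square flip: powr_add)
    also have "(norm (\<alpha> n) powr q) powr (2 / q) = (norm (\<alpha> n))\<^sup>2"
      using gt(2) \<open>0 < norm (\<alpha> n)\<close> by (simp add: powr_powr)
    finally show ?thesis by (simp add: power_mult_distrib)
  qed
  have "(\<Sum>n<m. (s n powr (1 - p / 2) * norm (\<alpha> n))\<^sup>2)
      \<le> (2 - p) / p * (\<Sum>n<m. s n powr p) + 2 / q * (\<Sum>n<m. norm (\<alpha> n) powr q)"
    unfolding sum_distrib_left sum.distrib[symmetric] by (intro sum_mono young)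
  also have "\<dots> \<le> (2 - p) / p * 1 + 2 / q * 1"
    using gt s(2) \<alpha> assms(2) by (intro add_mono mult_left_mono) auto
  finally show ?thesis using eq by simp
qed

lemma Holder_lp_ball:
  fixes \<alpha> :: "nat \<Rightarrow> 'a::real_normed_vector" and x :: "nat \<Rightarrow> 'b::real_normed_vector"
  assumes p: "1 \<le> p" and \<alpha>: "\<alpha> \<in> lp_ball (conj_index (ereal p))"
    and R: "0 < R" "(\<Sum>n<m. norm (x n) powr p) \<le> R powr p"
  shows "(\<Sum>n<m. norm (\<alpha> n) * norm (x n)) \<le> R"
proof -
  have "(\<Sum>n<m. (norm (x n) / R) powr p) \<le> 1"
    using R by (simp add: powr_divide flip: sum_divide_distrib)
  then have "(\<Sum>n<m. norm (\<alpha> n) * (norm (x n) / R)) \<le> 1"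
    using R(1) by (intro Holder_lp_ball_unit[OF p \<alpha>]) auto
  then have "(\<Sum>n<m. norm (\<alpha> n) * norm (x n)) / R \<le> 1"
    by (simp add: sum_divide_distrib)
  then show ?thesis using R(1) by (simp add: field_simps)
qed

lemma closed_lp_ball_conj:
  assumes "1 \<le> p"
  shows "closed (lp_ball (conj_index (ereal p)) :: (nat \<Rightarrow> 'a::real_normed_vector) set)"
proof -
  show ?thesis
  proof (cases rule: lp_ball_conj_cases[OF assms, where 'a='a, case_names one gt])
    case one
    have "lp_ball (conj_index (ereal p)) = (\<Inter>n. {\<alpha>::nat \<Rightarrow> 'a. norm (\<alpha> n) \<le> 1})"
      using one by auto
    also have "closed \<dots>"
      by (intro closed_INT ballI closed_Collect_le continuous_on_norm continuous_on_const) simp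
    finally show ?thesis .
  next
    case (gt q)
    have "lp_ball (conj_index (ereal p)) = (\<Inter>m. {\<alpha>::nat \<Rightarrow> 'a. (\<Sum>n<m. norm (\<alpha> n) powr q) \<le> 1})"
      using gt by auto
    also have "closed \<dots>"
      using gt by (intro closed_INT ballI closed_Collect_le continuous_on_sum continuous_on_powr'
          continuous_on_norm continuous_on_const) auto
    finally show ?thesis .
  qed
qed

text \<open>Sequences carry the product topology. By Tychonoff the product of the scalar unit balls
  is compact, and the ball is a closed subset of it.\<close>

lemma compact_lp_ball_conj:
  assumes "1 \<le> p"
  shows "compact (lp_ball (conj_index (ereal p)) :: (nat \<Rightarrow> 'k::real_or_complex) set)"
proof -
  have "compactin (product_topology (\<lambda>_::nat. euclidean) UNIV) (PiE UNIV (\<lambda>_. cball (0::'k) 1))"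
    unfolding compactin_PiE by (simp add: compact_cball_scalars)
  then have "compact (PiE UNIV (\<lambda>_::nat. cball (0::'k) 1))"
    by (simp add: euclidean_product_topology)
  then have "compact (lp_ball (conj_index (ereal p)) \<inter> PiE UNIV (\<lambda>_::nat. cball (0::'k) 1))"
    by (intro closed_Int_compact closed_lp_ball_conj assms)
  moreover have "lp_ball (conj_index (ereal p)) \<subseteq> PiE UNIV (\<lambda>_::nat. cball (0::'k) 1)"
    using norm_le_1_of_lp_ball[OF assms] by (auto simp: PiE_iff)
  ultimately show ?thesis by (simp add: Int_absorb2)
qed

lemma sum_powr_le_lp_norm:
  assumes "1 \<le> p" "in_lp (ereal p) x"
  shows "(\<Sum>n<m. norm (x n) powr p) \<le> lp_norm (ereal p) x powr p"
proof -
  have sm: "summable (\<lambda>n. norm (x n) powr p)" using assms by (simp add: in_lp_def)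
  then have "(\<Sum>n<m. norm (x n) powr p) \<le> (\<Sum>n. norm (x n) powr p)"
    by (intro sum_le_suminf) auto
  also have "\<dots> = lp_norm (ereal p) x powr p"
    using assms(1) suminf_nonneg[OF sm] by (simp add: lp_norm_def powr_powr)
  finally show ?thesis .
qed

subsection \<open>Finite families of operators\<close>

text \<open>The \<open>itself\<close> argument only selects the space. The inequality is the squared
  cotype 2 inequality for all vectors of the type.\<close>

definition cotype_2_const :: "real \<Rightarrow> 'v::real_normed_vector itself \<Rightarrow> bool" where
  "cotype_2_const C _ \<longleftrightarrow> 0 < C \<and>
    (\<forall>n (w::nat \<Rightarrow> 'v). (\<Sum>i<n. (norm (w i))\<^sup>2) \<le>
      C\<^sup>2 * ((\<Sum>\<epsilon>\<in>signs n. (norm (\<Sum>i<n. \<epsilon> i *\<^sub>R w i))\<^sup>2) / 2 ^ n))"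

text \<open>For finite \<open>I\<close> this says that the real-linear map from
  \<open>\<ell>\<^sub>\<infinity>(I)\<close> which sends the unit vectors to the \<open>E i\<close>
  has norm at most \<open>M\<close>.\<close>

definition sup_bounded :: "real \<Rightarrow> 'i set \<Rightarrow> ('i \<Rightarrow> 'v::real_normed_vector) \<Rightarrow> bool" where
  "sup_bounded M I E \<longleftrightarrow> finite I \<and>
    (\<forall>t. (\<forall>i\<in>I. \<bar>t i\<bar> \<le> 1) \<longrightarrow> norm (\<Sum>i\<in>I. t i *\<^sub>R E i) \<le> M)"

lemma sup_boundedD:
  assumes "sup_bounded M I E" "0 < r" "\<And>i. i \<in> I \<Longrightarrow> \<bar>t i\<bar> \<le> r"
  shows "norm (\<Sum>i\<in>I. t i *\<^sub>R E i) \<le> r * M"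
proof -
  have "\<forall>i\<in>I. \<bar>t i / r\<bar> \<le> 1" using assms(2,3) by (simp add: abs_divide)
  then have "norm (\<Sum>i\<in>I. (t i / r) *\<^sub>R E i) \<le> M"
    using assms(1) spec[where x = "\<lambda>i. t i / r"] unfolding sup_bounded_def by blast
  also have "(\<Sum>i\<in>I. (t i / r) *\<^sub>R E i) = (1 / r) *\<^sub>R (\<Sum>i\<in>I. t i *\<^sub>R E i)"
    by (simp add: scaleR_sum_right)
  finally show ?thesis using assms(2) by (simp add: field_simps)
qed

text \<open>A functional \<open>u\<close> norming the sum turns the operators into elements
  \<open>v i\<close> of the real dual of \<open>'x\<close>. Exchanging the sums leaves the norms
  \<open>c n\<close> of the combinations of the \<open>v i\<close> paired with the norms of the
  \<open>x n\<close>. Cauchy--Schwarz separates the weighted \<open>c n\<close>, bounded by the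
  2-summing estimate, from weights whose squares sum to at most 1.\<close>

lemma real_family_bound:
  fixes E :: "'i \<Rightarrow> 'x::real_normed_vector \<Rightarrow>\<^sub>L 'y::real_normed_vector" and x :: "nat \<Rightarrow> 'x"
    and \<alpha> :: "'i \<Rightarrow> nat \<Rightarrow> 'k::real_normed_vector"
  assumes C: "cotype_2_const C TYPE('x \<Rightarrow>\<^sub>L real)" and E: "sup_bounded M I E"
    and p: "1 \<le> p" "p \<le> 2"
    and \<alpha>: "\<And>i. i \<in> I \<Longrightarrow> \<alpha> i \<in> lp_ball (conj_index (ereal p))"
    and a: "\<And>i n. i \<in> I \<Longrightarrow> \<bar>a i n\<bar> \<le> norm (\<alpha> i n)"
    and R: "0 < R" "(\<Sum>n<m. norm (x n) powr p) \<le> R powr p"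
  shows "norm (\<Sum>i\<in>I. E i (\<Sum>n<m. a i n *\<^sub>R x n)) \<le> 7 * C\<^sup>2 * M * R"
proof -
  define y where "y = (\<Sum>i\<in>I. E i (\<Sum>n<m. a i n *\<^sub>R x n))"
  obtain u :: "'y \<Rightarrow>\<^sub>L real" where u: "norm u \<le> 1" "blinfun_apply u y = norm y"
    by (rule norming_functional)
  have I: "finite I" using E by (simp add: sup_bounded_def)
  have M0: "0 \<le> M" using sup_boundedD[OF E, of 1 "\<lambda>_. 0"] by simp
  define v where "v i = u o\<^sub>L E i" for i
  define s where "s n = norm (x n) / R" for n
  \<comment> \<open>The exponent is chosen so that for each \<open>i\<close> the squares of
    \<open>h n i\<close> sum to at most 1, while the complementary weight
    \<open>s n powr (p / 2)\<close> has square \<open>s n powr p\<close>.\<close>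
  define h where "h n i = s n powr (1 - p / 2) * a i n" for n i
  define c where "c n = norm (\<Sum>i\<in>I. a i n *\<^sub>R v i)" for n
  have s: "0 \<le> s n" for n using R by (simp add: s_def)
  have s_sum: "(\<Sum>n<m. s n powr p) \<le> 1"
    using R by (simp add: s_def powr_divide flip: sum_divide_distrib)
  have "norm (\<Sum>i\<in>I. t i *\<^sub>R v i) \<le> M" if "\<And>i. i \<in> I \<Longrightarrow> \<bar>t i\<bar> \<le> 1" for t
  proof -
    have "(\<Sum>i\<in>I. t i *\<^sub>R v i) = u o\<^sub>L (\<Sum>i\<in>I. t i *\<^sub>R E i)"
      by (rule blinfun_eqI) (simp add: v_def blinfun.sum_left blinfun.sum_right blinfun.scaleR_left blinfun.scaleR_right)
    also have "norm \<dots> \<le> norm u * norm (\<Sum>i\<in>I. t i *\<^sub>R E i)"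
      by (rule norm_blinfun_compose)
    also have "\<dots> \<le> 1 * M"
      using u(1) sup_boundedD[OF E, of 1 t] that by (intro mult_mono) auto
    finally show ?thesis by simp
  qed
  moreover have "(\<Sum>n<m. (h n i)\<^sup>2) \<le> 1" if "i \<in> I" for i
  proof -
    have "(\<Sum>n<m. (h n i)\<^sup>2) \<le> (\<Sum>n<m. (s n powr (1 - p / 2) * norm (\<alpha> i n))\<^sup>2)"
      unfolding h_def using a[OF that] by (intro sum_mono) (simp add: power_mult_distrib abs_le_square_iff[symmetric] mult_left_mono)
    also have "\<dots> \<le> 1"
      by (rule weighted_square_sum_lp_ball[OF p \<alpha>[OF that] s s_sum])
    finally show ?thesis .
  qed
  ultimately have "(\<Sum>n<m. (norm (\<Sum>i\<in>I. h n i *\<^sub>R v i))\<^sup>2) \<le> 48 * C ^ 4 * M\<^sup>2"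
    using C I unfolding cotype_2_const_def by (intro two_summing_of_cotype_2) auto
  moreover have "norm (\<Sum>i\<in>I. h n i *\<^sub>R v i) = s n powr (1 - p / 2) * c n" for n
  proof -
    have "(\<Sum>i\<in>I. h n i *\<^sub>R v i) = s n powr (1 - p / 2) *\<^sub>R (\<Sum>i\<in>I. a i n *\<^sub>R v i)"
      by (simp add: h_def scaleR_sum_right)
    then show ?thesis by (simp add: c_def)
  qed
  ultimately have cs: "(\<Sum>n<m. (s n powr (1 - p / 2) * c n)\<^sup>2) \<le> 48 * C ^ 4 * M\<^sup>2" by simp
  have "(\<Sum>n<m. c n * s n)\<^sup>2 = (\<Sum>n<m. (s n powr (1 - p / 2) * c n) * s n powr (p / 2))\<^sup>2"
  proof -
    have "s n powr (1 - p / 2) * s n powr (p / 2) = s n" for n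
      using s[of n] by (simp flip: powr_add)
    then have "c n * s n = (s n powr (1 - p / 2) * c n) * s n powr (p / 2)" for n
      by (metis mult.assoc mult.commute)
    then show ?thesis by (simp only:)
  qed
  also have "\<dots> \<le> (\<Sum>n<m. (s n powr (1 - p / 2) * c n)\<^sup>2) * (\<Sum>n<m. (s n powr (p / 2))\<^sup>2)"
    by (rule Cauchy_Schwarz_ineq_sum)
  also have "(\<Sum>n<m. (s n powr (p / 2))\<^sup>2) = (\<Sum>n<m. s n powr p)"
    by (simp add: power2_eq_square flip: powr_add)
  also have "(\<Sum>n<m. (s n powr (1 - p / 2) * c n)\<^sup>2) * (\<Sum>n<m. s n powr p) \<le> (48 * C ^ 4 * M\<^sup>2) * 1"
    using cs s_sum by (intro mult_mono) (auto intro: sum_nonneg)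
  \<comment> \<open>The constant 7 is the rounded square root of 48.\<close>
  also have "\<dots> \<le> (7 * C\<^sup>2 * M)\<^sup>2"
    by (simp add: power_mult_distrib mult_right_mono)
  finally have cs_le: "(\<Sum>n<m. c n * s n) \<le> 7 * C\<^sup>2 * M"
    by (rule power2_le_imp_le) (use M0 in simp)
  have "norm y = u y" using u(2) by simp
  also have "\<dots> = (\<Sum>i\<in>I. \<Sum>n<m. a i n * v i (x n))"
    by (simp add: y_def v_def blinfun.sum_right blinfun.scaleR_right)
  also have "\<dots> = (\<Sum>n<m. (\<Sum>i\<in>I. a i n *\<^sub>R v i) (x n))"
    by (subst sum.swap) (simp add: blinfun.sum_left blinfun.scaleR_left)
  also have "\<dots> \<le> (\<Sum>n<m. c n * norm (x n))"
  proof (rule sum_mono)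
    show "(\<Sum>i\<in>I. a i n *\<^sub>R v i) (x n) \<le> c n * norm (x n)" for n
      using norm_blinfun[of "\<Sum>i\<in>I. a i n *\<^sub>R v i" "x n"] by (simp add: c_def)
  qed
  also have "\<dots> = R * (\<Sum>n<m. c n * s n)"
    using R(1) by (simp add: s_def sum_distrib_left)
  also have "\<dots> \<le> R * (7 * C\<^sup>2 * M)"
    using cs_le R(1) by (intro mult_left_mono) auto
  finally show ?thesis by (simp add: y_def mult_ac)
qed

context normed_over
begin

text \<open>The coefficients are split into real and imaginary parts. The factor \<open>j\<close> of
  the imaginary part moves to the vectors, whose norms it does not increase; hence twice the real
  constant.\<close>

lemma family_bound:
  fixes E :: "'i \<Rightarrow> 'a \<Rightarrow>\<^sub>L 'y::real_normed_vector"
  assumes C: "cotype_2_const C TYPE('a \<Rightarrow>\<^sub>L real)" and E: "sup_bounded M I E"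
    and p: "1 \<le> p" "p \<le> 2"
    and \<alpha>: "\<And>i. i \<in> I \<Longrightarrow> \<alpha> i \<in> lp_ball (conj_index (ereal p))"
    and R: "0 < R" "(\<Sum>n<m. norm (x n) powr p) \<le> R powr p"
  shows "norm (\<Sum>i\<in>I. E i (\<Sum>n<m. scale (\<alpha> i n) (x n))) \<le> 14 * C\<^sup>2 * M * R"
proof -
  obtain j :: 'k where j: "norm j \<le> 1"
    "\<forall>z. \<exists>a b. z = of_real a + of_real b * j \<and> \<bar>a\<bar> \<le> norm z \<and> \<bar>b\<bar> \<le> norm z"
    by (rule real_imag_parts)
  obtain a b where ab: "\<And>z. z = of_real (a z) + of_real (b z) * j"
    "\<And>z. \<bar>a z\<bar> \<le> norm z" "\<And>z. \<bar>b z\<bar> \<le> norm z"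
    using j(2) by metis
  have split: "scale z y = a z *\<^sub>R y + b z *\<^sub>R scale j y" for z y
    by (subst ab(1)[of z]) (rule scale_of_real_add)
  have "(\<Sum>n<m. norm (scale j (x n)) powr p) \<le> (\<Sum>n<m. norm (x n) powr p)"
    using j(1) p by (intro sum_mono powr_mono2) (auto simp: norm_scale mult_left_le_one_le)
  then have R': "(\<Sum>n<m. norm (scale j (x n)) powr p) \<le> R powr p" using R(2) by simp
  have "(\<Sum>i\<in>I. E i (\<Sum>n<m. scale (\<alpha> i n) (x n))) =
      (\<Sum>i\<in>I. E i (\<Sum>n<m. a (\<alpha> i n) *\<^sub>R x n)) + (\<Sum>i\<in>I. E i (\<Sum>n<m. b (\<alpha> i n) *\<^sub>R scale j (x n)))"
    by (subst split) (simp add: sum.distrib blinfun.add_right)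
  also have "norm \<dots> \<le> 7 * C\<^sup>2 * M * R + 7 * C\<^sup>2 * M * R"
    by (intro norm_triangle_mono real_family_bound[OF C E p \<alpha> ab(2) R] real_family_bound[OF C E p \<alpha> ab(3) R(1) R'])
  finally show ?thesis by (simp add: mult_ac)
qed

text \<open>Here smallness comes from the coefficients and not from the vectors. For each fixed
  \<open>n\<close> the combination of the \<open>E i\<close> with coefficients bounded by \<eta> has
  norm at most \<open>\<eta> * M\<close>, so the triangle inequality over the finitely many
  \<open>n\<close> is affordable, without cotype.\<close>

lemma family_bound_finite:
  fixes E :: "'i \<Rightarrow> 'a \<Rightarrow>\<^sub>L 'y::real_normed_vector"
  assumes E: "sup_bounded M I E" and \<eta>: "0 < \<eta>" "\<And>i n. i \<in> I \<Longrightarrow> n < m \<Longrightarrow> norm (\<gamma> i n) \<le> \<eta>"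
  shows "norm (\<Sum>i\<in>I. E i (\<Sum>n<m. scale (\<gamma> i n) (x n))) \<le> 2 * \<eta> * M * (\<Sum>n<m. norm (x n))"
proof -
  obtain j :: 'k where j: "norm j \<le> 1"
    "\<forall>z. \<exists>a b. z = of_real a + of_real b * j \<and> \<bar>a\<bar> \<le> norm z \<and> \<bar>b\<bar> \<le> norm z"
    by (rule real_imag_parts)
  obtain a b where ab: "\<And>z. z = of_real (a z) + of_real (b z) * j"
    "\<And>z. \<bar>a z\<bar> \<le> norm z" "\<And>z. \<bar>b z\<bar> \<le> norm z"
    using j(2) by metis
  have split: "scale z y = a z *\<^sub>R y + b z *\<^sub>R scale j y" for z y
    by (subst ab(1)[of z]) (rule scale_of_real_add)
  have M0: "0 \<le> M" using sup_boundedD[OF E, of 1 "\<lambda>_. 0"] by simp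
  have bound: "norm (blinfun_apply (\<Sum>i\<in>I. t i *\<^sub>R E i) y) \<le> \<eta> * M * norm (x n)"
    if "\<And>i. i \<in> I \<Longrightarrow> \<bar>t i\<bar> \<le> \<eta>" "norm y \<le> norm (x n)" for t y n
    using sup_boundedD[OF E \<eta>(1) that(1)] that(2) \<eta>(1) M0
    by (intro norm_blinfun[THEN order_trans] mult_mono) auto
  have "(\<Sum>i\<in>I. E i (\<Sum>n<m. scale (\<gamma> i n) (x n))) =
      (\<Sum>n<m. blinfun_apply (\<Sum>i\<in>I. a (\<gamma> i n) *\<^sub>R E i) (x n)) +
      (\<Sum>n<m. blinfun_apply (\<Sum>i\<in>I. b (\<gamma> i n) *\<^sub>R E i) (scale j (x n)))"
    by (subst split) (simp add: sum.distrib blinfun.add_right blinfun.sum_right blinfun.sum_left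
      blinfun.scaleR_left blinfun.scaleR_right sum.swap[of _ I])
  also have "norm \<dots> \<le> (\<Sum>n<m. \<eta> * M * norm (x n)) + (\<Sum>n<m. \<eta> * M * norm (x n))"
  proof (intro norm_triangle_mono norm_sum[THEN order_trans] sum_mono bound)
    fix n i assume "n \<in> {..<m}" "i \<in> I"
    then show "\<bar>a (\<gamma> i n)\<bar> \<le> \<eta>" "\<bar>b (\<gamma> i n)\<bar> \<le> \<eta>"
      using \<eta>(2)[of i n] ab(2,3)[of "\<gamma> i n"] by auto
  qed (use j(1) in \<open>auto simp: norm_scale mult_left_le_one_le\<close>)
  finally show ?thesis by (simp add: sum_distrib_left mult_ac)
qed

end

section \<open>Infinite p-combinations, their tails and their continuity\<close>

lemma in_lp_bounded:
  assumes "1 \<le> p" "in_lp (ereal p) x"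
  obtains R where "0 < R" "\<forall>m. (\<Sum>n<m. norm (x n) powr p) \<le> R powr p"
proof (rule that[of "lp_norm (ereal p) x + 1"])
  have 0: "0 \<le> lp_norm (ereal p) x" by (simp add: lp_norm_def)
  then show "0 < lp_norm (ereal p) x + 1" by simp
  show "\<forall>m. (\<Sum>n<m. norm (x n) powr p) \<le> (lp_norm (ereal p) x + 1) powr p"
    using sum_powr_le_lp_norm[OF assms] powr_mono2[of p "lp_norm (ereal p) x" "lp_norm (ereal p) x + 1"] 0 assms(1)
    by (auto intro: order_trans)
qed

text \<open>Initial entries are replaced by 0 instead of being shifted away, so that a coefficient
  sequence keeps its indices and can be used unchanged for the tail.\<close>

definition tail :: "nat \<Rightarrow> (nat \<Rightarrow> 'a::zero) \<Rightarrow> nat \<Rightarrow> 'a" where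
  "tail N x n = (if n < N then 0 else x n)"

lemma tail_lp_small:
  assumes "1 \<le> p" "in_lp (ereal p) x" "0 < \<rho>"
  obtains N where "\<forall>m. (\<Sum>n<m. norm (tail N x n) powr p) \<le> \<rho> powr p"
proof -
  have "summable (\<lambda>n. norm (x n) powr p)" using assms by (simp add: in_lp_def)
  then obtain N where N: "\<And>k m. N \<le> k \<Longrightarrow> norm (\<Sum>n=k..<m. norm (x n) powr p) < \<rho> powr p"
    unfolding summable_Cauchy using assms(3) by (metis powr_gt_zero less_irrefl)
  have "(\<Sum>n<m. norm (tail N x n) powr p) \<le> \<rho> powr p" for m
  proof -
    have "(\<Sum>n<m. norm (tail N x n) powr p) = (\<Sum>n=N..<m. norm (x n) powr p)"
      by (rule sum.mono_neutral_cong_right) (auto simp: tail_def)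
    also have "\<dots> \<le> \<rho> powr p" using N[of N m] by simp
    finally show ?thesis .
  qed
  then show ?thesis by (intro that) blast
qed

locale banach_over = normed_over scale
  for scale :: "'k::real_or_complex \<Rightarrow> 'a::banach \<Rightarrow> 'a"
begin

definition combination :: "(nat \<Rightarrow> 'a) \<Rightarrow> (nat \<Rightarrow> 'k) \<Rightarrow> 'a" where
  "combination x \<alpha> = (\<Sum>n. scale (\<alpha> n) (x n))"

lemma summable_combination:
  assumes p: "1 \<le> p" and \<alpha>: "\<alpha> \<in> lp_ball (conj_index (ereal p))"
    and R: "0 < R" "\<And>m. (\<Sum>n<m. norm (x n) powr p) \<le> R powr p"
  shows "summable (\<lambda>n. scale (\<alpha> n) (x n))" and "norm (combination x \<alpha>) \<le> R"
proof -
  have le: "(\<Sum>n<m. norm (scale (\<alpha> n) (x n))) \<le> R" for m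
    using Holder_lp_ball[OF p \<alpha> R] by (simp add: norm_scale)
  then have "summable (\<lambda>n. norm (scale (\<alpha> n) (x n)))"
    by (intro summableI_nonneg_bounded) auto
  then show sm: "summable (\<lambda>n. scale (\<alpha> n) (x n))" by (rule summable_norm_cancel)
  show "norm (combination x \<alpha>) \<le> R"
    unfolding combination_def
    by (rule Lim_bounded[OF tendsto_norm[OF summable_LIMSEQ[OF sm]], of 0])
      (auto intro: norm_sum[THEN order_trans] le)
qed

lemma combination_tail:
  assumes "1 \<le> p" "\<alpha> \<in> lp_ball (conj_index (ereal p))" "in_lp (ereal p) x"
  shows "combination x \<alpha> = (\<Sum>n<N. scale (\<alpha> n) (x n)) + combination (tail N x) \<alpha>"
proof -
  obtain R where R: "0 < R" "\<forall>m. (\<Sum>n<m. norm (x n) powr p) \<le> R powr p"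
    by (rule in_lp_bounded[OF assms(1,3)])
  have sm: "summable (\<lambda>n. scale (\<alpha> n) (x n))"
    by (rule summable_combination[OF assms(1,2) R(1)]) (use R(2) in blast)
  let ?h = "\<lambda>n. if n \<in> {..<N} then scale (\<alpha> n) (x n) else 0"
  have h: "?h sums (\<Sum>n<N. scale (\<alpha> n) (x n))"
    by (rule sums_If_finite_set) simp
  have "(\<lambda>n. scale (\<alpha> n) (x n) - ?h n) sums (combination x \<alpha> - (\<Sum>n<N. scale (\<alpha> n) (x n)))"
    unfolding combination_def by (intro sums_diff summable_sums sm h)
  moreover have "(\<lambda>n. scale (\<alpha> n) (x n) - ?h n) = (\<lambda>n. scale (\<alpha> n) (tail N x n))"
    by (auto simp: tail_def fun_eq_iff)
  ultimately show ?thesis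
    unfolding combination_def[of "tail N x"] by (simp add: sums_iff)
qed

text \<open>The finite sums depend on finitely many coordinates and are continuous. By Hoelder the
  remainder is at most the p-norm of a tail of \<open>x\<close>, uniformly over the ball, so the
  limit is uniform.\<close>

lemma continuous_on_combination:
  assumes p: "1 \<le> p" and x: "in_lp (ereal p) x"
  shows "continuous_on (lp_ball (conj_index (ereal p))) (combination x)"
proof (rule uniform_limit_theorem)
  let ?B = "lp_ball (conj_index (ereal p)) :: (nat \<Rightarrow> 'k) set"
  show "\<forall>\<^sub>F N in sequentially. continuous_on ?B (\<lambda>\<alpha>. \<Sum>n<N. scale (\<alpha> n) (x n))"
  proof (intro always_eventually allI continuous_on_sum)
    fix n
    have "continuous_on ?B (\<lambda>\<alpha>. \<alpha> n)"
      by (rule continuous_on_subset[OF continuous_on_product_coordinates]) simp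
    then show "continuous_on ?B (\<lambda>\<alpha>. scale (\<alpha> n) (x n))"
      by (rule bounded_linear.continuous_on[OF bounded_linear_scale_left])
  qed
  show "uniform_limit ?B (\<lambda>N \<alpha>. \<Sum>n<N. scale (\<alpha> n) (x n)) (combination x) sequentially"
  proof (rule uniform_limitI)
    fix e :: real assume e: "0 < e"
    obtain N where N: "\<forall>m. (\<Sum>n<m. norm (tail N x n) powr p) \<le> (e / 2) powr p"
      by (rule tail_lp_small[OF p x, of "e / 2"]) (use e in auto)
    have "dist (\<Sum>n<K. scale (\<alpha> n) (x n)) (combination x \<alpha>) < e"
      if "N \<le> K" "\<alpha> \<in> ?B" for K \<alpha>
    proof -
      have "(\<Sum>n<m. norm (tail K x n) powr p) \<le> (e / 2) powr p" for m
      proof -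
        have "(\<Sum>n<m. norm (tail K x n) powr p) \<le> (\<Sum>n<m. norm (tail N x n) powr p)"
          using \<open>N \<le> K\<close> by (intro sum_mono) (auto simp: tail_def)
        with N show ?thesis by (meson order_trans)
      qed
      then have "norm (combination (tail K x) \<alpha>) \<le> e / 2"
        using e by (intro summable_combination(2)[OF p \<open>\<alpha> \<in> ?B\<close>]) auto
      then show ?thesis
        using e combination_tail[OF p \<open>\<alpha> \<in> ?B\<close> x, of K] by (simp add: dist_norm)
    qed
    then show "\<forall>\<^sub>F K in sequentially. \<forall>\<alpha>\<in>?B. dist (\<Sum>n<K. scale (\<alpha> n) (x n)) (combination x \<alpha>) < e"
      unfolding eventually_sequentially by blast
  qed
qed simp

text \<open>
  Compactness of the ball for coordinatewise convergence replaces a continuous lifting of the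
  functions in \<open>\<C>\<^sub>p\<close> to \<open>\<ell>\<^sub>p\<^sub>'\<close>.
\<close>

lemma close_combinations:
  assumes p: "1 \<le> p" and x: "in_lp (ereal p) x" and \<eta>: "0 < \<eta>"
  defines "B \<equiv> lp_ball (conj_index (ereal p))"
  obtains \<delta> where "0 < \<delta>"
    "\<forall>\<alpha>\<in>B. \<forall>\<beta>\<in>B. norm (combination x \<alpha> - combination x \<beta>) < \<delta> \<longrightarrow>
      (\<exists>\<alpha>'\<in>B. \<exists>\<beta>'\<in>B. combination x \<alpha>' = combination x \<beta>' \<and>
        (\<forall>n<N. norm ((\<alpha> n - \<beta> n) - (\<alpha>' n - \<beta>' n)) < \<eta>))"
proof -
  define F where "F w = combination x (fst w) - combination x (snd w)" for w
  \<comment> \<open>\<open>G\<close> is open and contains every pair in \<open>B \<times> B\<close>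
    with equal combinations. On the compact set \<open>B \<times> B - G\<close> the norm of
    \<open>F\<close> therefore has a positive minimum, which becomes \<delta>.\<close>
  define G where "G = (\<Union>z\<in>{z \<in> B \<times> B. F z = 0}.
    \<Inter>n\<in>{..<N}. {w. norm ((fst w n - snd w n) - (fst z n - snd z n)) < \<eta>})"
  have coord: "continuous_on UNIV (\<lambda>w :: (nat \<Rightarrow> 'k) \<times> (nat \<Rightarrow> 'k). fst w n)"
    "continuous_on UNIV (\<lambda>w :: (nat \<Rightarrow> 'k) \<times> (nat \<Rightarrow> 'k). snd w n)" for n
    by (rule continuous_on_compose2[OF continuous_on_product_coordinates[of n] continuous_on_fst[OF continuous_on_id]], simp)
      (rule continuous_on_compose2[OF continuous_on_product_coordinates[of n] continuous_on_snd[OF continuous_on_id]], simp)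
  have "open G"
    unfolding G_def
    by (intro open_UN open_INT ballI finite_lessThan open_Collect_less continuous_on_norm
        continuous_on_diff coord continuous_on_const)
  then have cpt: "compact (B \<times> B - G)"
    unfolding B_def by (intro compact_diff compact_Times compact_lp_ball_conj p)
  have "continuous_on (B \<times> B) F"
    unfolding F_def B_def
    by (intro continuous_on_diff continuous_on_compose2[OF continuous_on_combination[OF p x]]
        continuous_intros) auto
  then have cont: "continuous_on (B \<times> B - G) (\<lambda>w. norm (F w))"
    by (intro continuous_on_norm) (rule continuous_on_subset, auto)
  obtain \<delta> where \<delta>: "0 < \<delta>" "\<forall>w\<in>B \<times> B. norm (F w) < \<delta> \<longrightarrow> w \<in> G"
  proof (cases "B \<times> B - G = {}")
    case True
    then show ?thesis by (intro that[of 1]) auto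
  next
    case False
    obtain w0 where w0: "w0 \<in> B \<times> B - G" "\<And>w. w \<in> B \<times> B - G \<Longrightarrow> norm (F w0) \<le> norm (F w)"
      using continuous_attains_inf[OF cpt False cont] by blast
    have "F w0 \<noteq> 0"
    proof
      assume "F w0 = 0"
      then have "w0 \<in> G" using w0(1) \<eta> unfolding G_def by force
      with w0(1) show False by simp
    qed
    then show ?thesis using w0(2) by (intro that[of "norm (F w0)"]) force+
  qed
  show ?thesis
  proof (rule that[OF \<delta>(1)], intro ballI impI)
    fix \<alpha> \<beta> assume "\<alpha> \<in> B" "\<beta> \<in> B" "norm (combination x \<alpha> - combination x \<beta>) < \<delta>"
    then have "(\<alpha>, \<beta>) \<in> G" using \<delta>(2) by (auto simp: F_def)
    then show "\<exists>\<alpha>'\<in>B. \<exists>\<beta>'\<in>B. combination x \<alpha>' = combination x \<beta>' \<and>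
        (\<forall>n<N. norm ((\<alpha> n - \<beta> n) - (\<alpha>' n - \<beta>' n)) < \<eta>)"
      by (force simp: G_def F_def)
  qed
qed

lemma family_bound_combination:
  fixes E :: "'i \<Rightarrow> 'a \<Rightarrow>\<^sub>L 'y::real_normed_vector"
  assumes C: "cotype_2_const C TYPE('a \<Rightarrow>\<^sub>L real)" and E: "sup_bounded M I E"
    and p: "1 \<le> p" "p \<le> 2"
    and \<alpha>: "\<And>i. i \<in> I \<Longrightarrow> \<alpha> i \<in> lp_ball (conj_index (ereal p))"
    and R: "0 < R" "\<And>m. (\<Sum>n<m. norm (x n) powr p) \<le> R powr p"
  shows "norm (\<Sum>i\<in>I. E i (combination x (\<alpha> i))) \<le> 14 * C\<^sup>2 * M * R"
proof (rule Lim_bounded)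
  show "(\<lambda>m. norm (\<Sum>i\<in>I. E i (\<Sum>n<m. scale (\<alpha> i n) (x n)))) \<longlonglongrightarrow>
      norm (\<Sum>i\<in>I. E i (combination x (\<alpha> i)))"
    unfolding combination_def
    by (intro tendsto_norm tendsto_sum bounded_linear.tendsto[OF blinfun.bounded_linear_right]
        summable_LIMSEQ summable_combination(1)[OF p(1) \<alpha> R])
  show "\<forall>m\<ge>0. norm (\<Sum>i\<in>I. E i (\<Sum>n<m. scale (\<alpha> i n) (x n))) \<le> 14 * C\<^sup>2 * M * R"
    by (intro allI impI family_bound[OF C E p _ R] \<alpha>)
qed

text \<open>\<delta> is fixed before the family and the points, so that one choice serves all pairs
  of partitions. The first \<open>N\<close> coordinates are small after the correction by pairs with
  equal combinations; the tails are small through the cotype bound.\<close>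

lemma family_small:
  fixes f :: "'o \<Rightarrow> 'a"
  assumes C: "cotype_2_const C TYPE('a \<Rightarrow>\<^sub>L real)" and M: "0 < M"
    and p: "1 \<le> p" "p \<le> 2" and x: "in_lp (ereal p) x"
    and f: "\<And>\<omega>. \<exists>\<alpha>\<in>lp_ball (conj_index (ereal p)). f \<omega> = combination x \<alpha>" and e: "0 < e"
  obtains \<delta> where "0 < \<delta>"
    "\<forall>I (E :: 'i \<Rightarrow> 'a \<Rightarrow>\<^sub>L 'y::real_normed_vector) z w. sup_bounded M I E \<longrightarrow>
      (\<forall>i\<in>I. norm (f (z i) - f (w i)) < \<delta>) \<longrightarrow>
      norm (\<Sum>i\<in>I. blinfun_apply (E i) (f (z i) - f (w i))) \<le> e"
proof -
  let ?B = "lp_ball (conj_index (ereal p)) :: (nat \<Rightarrow> 'k) set"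
  have C0: "0 < C" using C by (simp add: cotype_2_const_def)
  \<comment> \<open>Four tail sums will occur, two from the given coefficients and two from the
    correction. With 112 equal to 8 times 14, each of them is at most \<open>e / 8\<close>; the
    first coordinates receive the other half of \<open>e\<close>.\<close>
  define \<rho> where "\<rho> = e / (112 * C\<^sup>2 * M)"
  have \<rho>: "0 < \<rho>" "14 * C\<^sup>2 * M * \<rho> = e / 8" using e C0 M by (auto simp: \<rho>_def)
  obtain N where N: "\<forall>m. (\<Sum>n<m. norm (tail N x n) powr p) \<le> \<rho> powr p"
    by (rule tail_lp_small[OF p(1) x \<rho>(1)])
  define s where "s = (\<Sum>n<N. norm (x n)) + 1"
  have s: "0 < s" by (simp add: s_def sum_nonneg add_nonneg_pos)
  define \<eta> where "\<eta> = e / (4 * M * s)"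
  have \<eta>: "0 < \<eta>" using e M s by (simp add: \<eta>_def)
  have "2 * \<eta> * M * (\<Sum>n<N. norm (x n)) \<le> 2 * \<eta> * M * s"
    using \<eta> M by (intro mult_left_mono) (auto simp: s_def)
  also have "\<dots> = e / 2" using M s by (simp add: \<eta>_def)
  finally have \<eta>s: "2 * \<eta> * M * (\<Sum>n<N. norm (x n)) \<le> e / 2" .
  obtain \<delta> where \<delta>: "0 < \<delta>"
    "\<forall>\<alpha>\<in>?B. \<forall>\<beta>\<in>?B. norm (combination x \<alpha> - combination x \<beta>) < \<delta> \<longrightarrow>
      (\<exists>\<alpha>'\<in>?B. \<exists>\<beta>'\<in>?B. combination x \<alpha>' = combination x \<beta>' \<and>
        (\<forall>n<N. norm ((\<alpha> n - \<beta> n) - (\<alpha>' n - \<beta>' n)) < \<eta>))"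
    by (rule close_combinations[OF p(1) x \<eta>])
  show ?thesis
  proof (rule that[OF \<delta>(1)], intro allI impI)
    fix I and E :: "'i \<Rightarrow> 'a \<Rightarrow>\<^sub>L 'y" and z w
    assume E: "sup_bounded M I E" and close: "\<forall>i\<in>I. norm (f (z i) - f (w i)) < \<delta>"
    obtain \<alpha>0 where \<alpha>0: "\<And>\<omega>. \<alpha>0 \<omega> \<in> ?B" "\<And>\<omega>. f \<omega> = combination x (\<alpha>0 \<omega>)"
      using f by metis
    have "\<forall>i\<in>I. \<exists>\<alpha>' \<beta>'. \<alpha>' \<in> ?B \<and> \<beta>' \<in> ?B \<and> combination x \<alpha>' = combination x \<beta>' \<and>
        (\<forall>n<N. norm ((\<alpha>0 (z i) n - \<alpha>0 (w i) n) - (\<alpha>' n - \<beta>' n)) < \<eta>)"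
      using \<delta>(2) close \<alpha>0 by (metis (no_types, lifting))
    then obtain \<alpha>' \<beta>' where ab: "\<And>i. i \<in> I \<Longrightarrow> \<alpha>' i \<in> ?B" "\<And>i. i \<in> I \<Longrightarrow> \<beta>' i \<in> ?B"
      "\<And>i. i \<in> I \<Longrightarrow> combination x (\<alpha>' i) = combination x (\<beta>' i)"
      "\<And>i n. i \<in> I \<Longrightarrow> n < N \<Longrightarrow> norm ((\<alpha>0 (z i) n - \<alpha>0 (w i) n) - (\<alpha>' i n - \<beta>' i n)) < \<eta>"
      by metis
    define \<gamma> where "\<gamma> i n = (\<alpha>0 (z i) n - \<alpha>0 (w i) n) - (\<alpha>' i n - \<beta>' i n)" for i n
    let ?t = "combination (tail N x)"
    have split: "f (z i) - f (w i) = (\<Sum>n<N. scale (\<gamma> i n) (x n)) +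
        (?t (\<alpha>0 (z i)) - ?t (\<alpha>0 (w i)) - (?t (\<alpha>' i) - ?t (\<beta>' i)))" if "i \<in> I" for i
    proof -
      \<comment> \<open>The subtracted difference is 0. It makes the coefficients of the first
        \<open>N\<close> vectors the small numbers \<open>\<gamma> i n\<close>, although the
        original differences need not be small.\<close>
      have "f (z i) - f (w i) = (combination x (\<alpha>0 (z i)) - combination x (\<alpha>0 (w i)))
          - (combination x (\<alpha>' i) - combination x (\<beta>' i))"
        using ab(3)[OF that] by (simp add: \<alpha>0(2))
      then show ?thesis
        unfolding combination_tail[OF p(1) \<alpha>0(1) x, of _ N] combination_tail[OF p(1) ab(1)[OF that] x, of N]
          combination_tail[OF p(1) ab(2)[OF that] x, of N]
        by (simp add: \<gamma>_def scale_left_diff_distrib sum_subtractf)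
    qed
    let ?S = "\<lambda>g. \<Sum>i\<in>I. E i (g i)"
    have "?S (\<lambda>i. f (z i) - f (w i)) = ?S (\<lambda>i. \<Sum>n<N. scale (\<gamma> i n) (x n)) +
        ((?S (\<lambda>i. ?t (\<alpha>0 (z i))) - ?S (\<lambda>i. ?t (\<alpha>0 (w i)))) -
         (?S (\<lambda>i. ?t (\<alpha>' i)) - ?S (\<lambda>i. ?t (\<beta>' i))))"
      by (simp add: split blinfun.add_right blinfun.diff_right sum.distrib sum_subtractf)
    also have "norm \<dots> \<le> e / 2 + ((e / 8 + e / 8) + (e / 8 + e / 8))"
    proof (intro norm_triangle_mono norm_triangle_le_diff add_mono)
      show "norm (?S (\<lambda>i. \<Sum>n<N. scale (\<gamma> i n) (x n))) \<le> e / 2"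
        using family_bound_finite[OF E \<eta>, of N \<gamma> x] ab(4) \<eta>s
        by (fastforce simp: \<gamma>_def intro: less_imp_le)
    qed (use family_bound_combination[OF C E p _ \<rho>(1) N[rule_format]] \<alpha>0(1) ab(1,2) \<rho>(2) in auto)
    finally show "norm (?S (\<lambda>i. f (z i) - f (w i))) \<le> e" by simp
  qed
qed

end

subsection \<open>Partitions of unity and the integral\<close>

type_synonym 'o tagged_functions = "'o set \<times> ('o \<Rightarrow> 'o \<Rightarrow> real)"

text \<open>Partitions of unity whose members are indexed by tag points.\<close>

definition tagged_partition :: "'o::topological_space tagged_functions \<Rightarrow> bool" where
  "tagged_partition P \<longleftrightarrow> finite (fst P) \<and>
    (\<forall>w\<in>fst P. continuous_on UNIV (snd P w) \<and> (\<forall>\<omega>. 0 \<le> snd P w \<omega>)) \<and>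
    (\<forall>\<omega>. (\<Sum>w\<in>fst P. snd P w \<omega>) = 1)"

text \<open>A gauge encodes the open neighbourhoods \<open>{\<omega>. d w \<omega> < 1}\<close> of
  the points \<open>w\<close> by continuous functions. Maxima of gauges give intersections of
  neighbourhoods, and \<open>max 0 (1 - d w \<omega>)\<close> is a bump function carried by the
  neighbourhood of \<open>w\<close>.\<close>

definition gauges :: "('o::topological_space \<Rightarrow> 'o \<Rightarrow> real) set" where
  "gauges = {d. \<forall>w. continuous_on UNIV (d w) \<and> d w w = 0}"

definition finer :: "('o \<Rightarrow> 'o \<Rightarrow> real) \<Rightarrow> 'o tagged_functions \<Rightarrow> bool" where
  "finer d P \<longleftrightarrow> (\<forall>w\<in>fst P. \<forall>\<omega>. snd P w \<omega> \<noteq> 0 \<longrightarrow> d w \<omega> < 1)"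

text \<open>Refinement expressed as a filter, so that the integral is an ordinary limit and its
  existence a Cauchy condition.\<close>

definition partitions :: "'o::topological_space tagged_functions filter" where
  "partitions = (INF d\<in>gauges. principal {P. tagged_partition P \<and> finer d P})"

lemma eventually_partitions:
  "eventually Q partitions \<longleftrightarrow> (\<exists>d\<in>gauges. \<forall>P. tagged_partition P \<longrightarrow> finer d P \<longrightarrow> Q P)"
proof -
  have "(\<lambda>_ _. 0) \<in> gauges" by (simp add: gauges_def)
  moreover have "\<exists>d\<in>gauges. principal {P. tagged_partition P \<and> finer d P}
      \<le> inf (principal {P. tagged_partition P \<and> finer d1 P}) (principal {P. tagged_partition P \<and> finer d2 P})"
    if "d1 \<in> gauges" "d2 \<in> gauges" for d1 d2 :: "'a \<Rightarrow> 'a \<Rightarrow> real"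
    using that
    by (intro bexI[of _ "\<lambda>w \<omega>. max (d1 w \<omega>) (d2 w \<omega>)"])
      (auto simp: gauges_def finer_def intro: continuous_on_max)
  ultimately have "eventually Q partitions \<longleftrightarrow>
      (\<exists>d\<in>gauges. eventually Q (principal {P. tagged_partition P \<and> finer d P}))"
    unfolding partitions_def by (intro eventually_INF_base) blast+
  then show ?thesis unfolding eventually_principal by blast
qed

text \<open>Finitely many of the neighbourhoods cover the space; their bump functions have a
  positive sum, and dividing by it gives the partition.\<close>

lemma fine_partition_exists:
  assumes cpt: "compact (UNIV :: 'o::topological_space set)" and d: "d \<in> gauges"
  obtains P :: "'o::topological_space tagged_functions" where "tagged_partition P" "finer d P"
proof -
  have cont: "continuous_on UNIV (d w)" and "d w w = 0" for w
    using d by (auto simp: gauges_def)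
  obtain W where W: "finite W" "UNIV \<subseteq> (\<Union>w\<in>W. {\<omega>. d w \<omega> < 1})"
  proof (rule compactE_image[OF cpt, of UNIV "\<lambda>w. {\<omega>. d w \<omega> < 1}"])
    show "open {\<omega>. d w \<omega> < 1}" for w
      by (intro open_Collect_less cont continuous_on_const)
    show "UNIV \<subseteq> (\<Union>w\<in>UNIV. {\<omega>. d w \<omega> < 1})"
      using \<open>\<And>w. d w w = 0\<close> by (auto intro!: exI[of _ _])
  qed
  define b where "b w \<omega> = max 0 (1 - d w \<omega>)" for w \<omega>
  define s where "s \<omega> = (\<Sum>w\<in>W. b w \<omega>)" for \<omega>
  have s: "0 < s \<omega>" for \<omega>
  proof -
    obtain w where "w \<in> W" "d w \<omega> < 1" using W(2) by blast
    then show ?thesis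
      unfolding s_def using W(1) by (intro sum_pos2[of W w]) (auto simp: b_def)
  qed
  have b: "continuous_on UNIV (b w)" for w
    unfolding b_def by (intro continuous_on_max continuous_on_diff continuous_on_const cont)
  show ?thesis
  proof (rule that[of "(W, \<lambda>w \<omega>. b w \<omega> / s \<omega>)"])
    have "continuous_on UNIV (\<lambda>\<omega>. b w \<omega> / s \<omega>)" for w
      using s unfolding s_def
      by (intro continuous_on_divide b continuous_on_sum) (auto simp: less_imp_neq[THEN not_sym])
    moreover have "(\<Sum>w\<in>W. b w \<omega> / s \<omega>) = 1" for \<omega>
      using s[of \<omega>] by (simp add: s_def flip: sum_divide_distrib)
    ultimately show "tagged_partition (W, \<lambda>w \<omega>. b w \<omega> / s \<omega>)"
      using W(1) s by (auto simp: tagged_partition_def b_def intro!: divide_nonneg_pos)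
    show "finer d (W, \<lambda>w \<omega>. b w \<omega> / s \<omega>)"
      by (auto simp: finer_def b_def max_def split: if_splits)
  qed
qed

lemma partitions_not_bot:
  assumes "compact (UNIV :: 'o::topological_space set)"
  shows "(partitions :: 'o::topological_space tagged_functions filter) \<noteq> bot"
  unfolding trivial_limit_def eventually_partitions by (metis fine_partition_exists[OF assms])

text \<open>\<open>m\<close> stands for the operator-valued map restricted to real functions, which
  suffices because partition functions are real. It is defined on all functions but constrained only
  on continuous ones; its values are merely real-linear in the vector.\<close>

locale operator_content = banach_over scale
  for scale :: "'k::real_or_complex \<Rightarrow> 'a::banach \<Rightarrow> 'a" +
  fixes m :: "('o::topological_space \<Rightarrow> real) \<Rightarrow> 'a \<Rightarrow>\<^sub>L 'y::banach" and M :: real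
  assumes compact_UNIV: "compact (UNIV :: 'o set)"
    and m_add: "\<And>g h. continuous_on UNIV g \<Longrightarrow> continuous_on UNIV h \<Longrightarrow>
      m (\<lambda>\<omega>. g \<omega> + h \<omega>) = m g + m h"
    and m_scale: "\<And>g r. continuous_on UNIV g \<Longrightarrow> m (\<lambda>\<omega>. r * g \<omega>) = r *\<^sub>R m g"
    and m_bound: "\<And>g. continuous_on UNIV g \<Longrightarrow> (\<And>\<omega>. \<bar>g \<omega>\<bar> \<le> 1) \<Longrightarrow> norm (m g) \<le> M"
    and M: "0 < M"
begin

definition riemann :: "('o \<Rightarrow> 'a) \<Rightarrow> 'o tagged_functions \<Rightarrow> 'y" where
  "riemann f P = (\<Sum>w\<in>fst P. m (snd P w) (f w))"

lemma m_sum: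
  assumes "finite I" "\<And>i. i \<in> I \<Longrightarrow> continuous_on UNIV (g i)"
  shows "m (\<lambda>\<omega>. \<Sum>i\<in>I. t i * g i \<omega>) = (\<Sum>i\<in>I. t i *\<^sub>R m (g i))"
  using assms
proof (induction I rule: finite_induct)
  case empty
  show ?case using m_scale[of "\<lambda>_. 0" 0] by simp
next
  case (insert i I)
  then have "m (\<lambda>\<omega>. t i * g i \<omega> + (\<Sum>i\<in>I. t i * g i \<omega>)) =
      m (\<lambda>\<omega>. t i * g i \<omega>) + m (\<lambda>\<omega>. \<Sum>i\<in>I. t i * g i \<omega>)"
    by (intro m_add continuous_on_mult_left continuous_on_sum) auto
  with insert show ?case by (simp add: m_scale)
qed

text \<open>Coefficients of modulus at most 1 on nonnegative functions with sum at most 1 give a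
  function of supremum norm at most 1.\<close>

lemma sup_bounded_m:
  assumes "finite I" "\<And>i. i \<in> I \<Longrightarrow> continuous_on UNIV (g i)"
    and "\<And>i \<omega>. i \<in> I \<Longrightarrow> 0 \<le> g i \<omega>" "\<And>\<omega>. (\<Sum>i\<in>I. g i \<omega>) \<le> 1"
  shows "sup_bounded M I (\<lambda>i. m (g i))"
  unfolding sup_bounded_def
proof (intro conjI allI impI assms(1))
  fix t :: "'b \<Rightarrow> real" assume t: "\<forall>i\<in>I. \<bar>t i\<bar> \<le> 1"
  have "\<bar>\<Sum>i\<in>I. t i * g i \<omega>\<bar> \<le> 1" for \<omega>
  proof -
    have "\<bar>\<Sum>i\<in>I. t i * g i \<omega>\<bar> \<le> (\<Sum>i\<in>I. g i \<omega>)"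
      using t assms(3)
      by (intro sum_abs[THEN order_trans] sum_mono) (auto simp: abs_mult mult_left_le_one_le)
    then show ?thesis by (rule order_trans[OF _ assms(4)])
  qed
  then have "norm (m (\<lambda>\<omega>. \<Sum>i\<in>I. t i * g i \<omega>)) \<le> M"
    by (intro m_bound continuous_on_sum continuous_on_mult_left assms(2))
  then show "norm (\<Sum>i\<in>I. t i *\<^sub>R m (g i)) \<le> M"
    by (simp add: m_sum assms(1,2))
qed

lemma riemann_add: "riemann (\<lambda>\<omega>. f \<omega> + g \<omega>) P = riemann f P + riemann g P"
  by (simp add: riemann_def blinfun.add_right sum.distrib)

text \<open>The products of the members form a common refinement. Only pairs whose product is not
  identically 0 are kept, because only their tags are tied together by a common point; the others
  contribute \<open>m\<close> of the zero function.\<close>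

lemma riemann_diff:
  assumes P: "tagged_partition P" and Q: "tagged_partition Q"
  defines "I \<equiv> {(w, v) \<in> fst P \<times> fst Q. \<exists>\<omega>. snd P w \<omega> * snd Q v \<omega> \<noteq> 0}"
    and "E \<equiv> (\<lambda>(w, v). m (\<lambda>\<omega>. snd P w \<omega> * snd Q v \<omega>))"
  shows "sup_bounded M I E"
    and "riemann f P - riemann f Q = (\<Sum>i\<in>I. E i (f (fst i) - f (snd i)))"
proof -
  have fin: "finite (fst P)" "finite (fst Q)" using P Q by (auto simp: tagged_partition_def)
  have cont: "continuous_on UNIV (\<lambda>\<omega>. snd P w \<omega> * snd Q v \<omega>)" if "w \<in> fst P" "v \<in> fst Q" for w v
    using P Q that by (intro continuous_on_mult) (auto simp: tagged_partition_def)
  have nonneg: "0 \<le> snd P w \<omega> * snd Q v \<omega>" if "w \<in> fst P" "v \<in> fst Q" for w v \<omega>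
    using P Q that by (auto simp: tagged_partition_def)
  have I: "I \<subseteq> fst P \<times> fst Q" "finite I"
    using fin by (auto simp: I_def intro: finite_subset[of _ "fst P \<times> fst Q"])
  have "sup_bounded M I (\<lambda>i. m (\<lambda>\<omega>. snd P (fst i) \<omega> * snd Q (snd i) \<omega>))"
  proof (rule sup_bounded_m[OF I(2)])
    fix \<omega>
    have "(\<Sum>i\<in>I. snd P (fst i) \<omega> * snd Q (snd i) \<omega>) \<le>
        (\<Sum>i\<in>fst P \<times> fst Q. snd P (fst i) \<omega> * snd Q (snd i) \<omega>)"
      using I fin nonneg by (intro sum_mono2) auto
    also have "\<dots> = (\<Sum>w\<in>fst P. snd P w \<omega>) * (\<Sum>v\<in>fst Q. snd Q v \<omega>)"
      by (simp add: sum_product sum.cartesian_product case_prod_beta)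
    also have "\<dots> = 1" using P Q by (simp add: tagged_partition_def)
    finally show "(\<Sum>i\<in>I. snd P (fst i) \<omega> * snd Q (snd i) \<omega>) \<le> 1" .
  qed (use I(1) cont nonneg in auto)
  then show "sup_bounded M I E" by (simp add: E_def case_prod_unfold)
  have mP: "m (snd P w) = (\<Sum>v\<in>fst Q. E (w, v))" if "w \<in> fst P" for w
  proof -
    have "(\<lambda>\<omega>. \<Sum>v\<in>fst Q. 1 * (snd P w \<omega> * snd Q v \<omega>)) = snd P w"
      using Q by (simp add: tagged_partition_def flip: sum_distrib_left)
    then show ?thesis
      using m_sum[OF fin(2), of "\<lambda>v \<omega>. snd P w \<omega> * snd Q v \<omega>" "\<lambda>_. 1"] cont that
      by (simp add: E_def)
  qed
  have mQ: "m (snd Q v) = (\<Sum>w\<in>fst P. E (w, v))" if "v \<in> fst Q" for v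
  proof -
    have "(\<lambda>\<omega>. \<Sum>w\<in>fst P. 1 * (snd P w \<omega> * snd Q v \<omega>)) = snd Q v"
      using P by (simp add: tagged_partition_def flip: sum_distrib_right)
    then show ?thesis
      using m_sum[OF fin(1), of "\<lambda>w \<omega>. snd P w \<omega> * snd Q v \<omega>" "\<lambda>_. 1"] cont that
      by (simp add: E_def)
  qed
  have "riemann f P = (\<Sum>w\<in>fst P. \<Sum>v\<in>fst Q. E (w, v) (f w))"
    unfolding riemann_def by (intro sum.cong refl) (simp add: mP blinfun.sum_left)
  moreover have "riemann f Q = (\<Sum>w\<in>fst P. \<Sum>v\<in>fst Q. E (w, v) (f v))"
    unfolding riemann_def by (subst sum.swap) (intro sum.cong refl, simp add: mQ blinfun.sum_left)
  ultimately have "riemann f P - riemann f Q = (\<Sum>i\<in>fst P \<times> fst Q. E i (f (fst i) - f (snd i)))"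
    by (simp add: sum.cartesian_product case_prod_beta blinfun.diff_right flip: sum_subtractf)
  also have "\<dots> = (\<Sum>i\<in>I. E i (f (fst i) - f (snd i)))"
  proof (rule sum.mono_neutral_right)
    have m0: "m (\<lambda>_. 0) = 0" using m_scale[of "\<lambda>_. 0" 0] by simp
    show "\<forall>i\<in>fst P \<times> fst Q - I. E i (f (fst i) - f (snd i)) = 0"
    proof
      fix i assume i: "i \<in> fst P \<times> fst Q - I"
      then have "(\<lambda>\<omega>. snd P (fst i) \<omega> * snd Q (snd i) \<omega>) = (\<lambda>_. 0)"
        by (force simp: I_def)
      then have "E i = 0" unfolding E_def case_prod_beta using m0 by (simp only:)
      then show "E i (f (fst i) - f (snd i)) = 0" by simp
    qed
  qed (use fin I in auto)
  finally show "riemann f P - riemann f Q = (\<Sum>i\<in>I. E i (f (fst i) - f (snd i)))" .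
qed

context
  fixes f :: "'o \<Rightarrow> 'a" and x :: "nat \<Rightarrow> 'a" and p C :: real
  assumes C: "cotype_2_const C TYPE('a \<Rightarrow>\<^sub>L real)" and p: "1 \<le> p" "p \<le> 2"
    and x: "in_lp (ereal p) x"
    and f: "\<And>\<omega>. \<exists>\<alpha>\<in>lp_ball (conj_index (ereal p)). f \<omega> = combination x \<alpha>"
begin

text \<open>\<open>R\<close> replaces the p-norm of \<open>x\<close> because that norm may be 0,
  while the weights are formed by division by a positive number.\<close>

lemma riemann_bound:
  assumes P: "tagged_partition P" and R: "0 < R" "lp_norm (ereal p) x \<le> R"
  shows "norm (riemann f P) \<le> 14 * C\<^sup>2 * M * R"
proof -
  obtain \<alpha> where \<alpha>: "\<And>\<omega>. \<alpha> \<omega> \<in> lp_ball (conj_index (ereal p))" "\<And>\<omega>. f \<omega> = combination x (\<alpha> \<omega>)"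
    using f by metis
  have E: "sup_bounded M (fst P) (\<lambda>w. m (snd P w))"
    using P by (intro sup_bounded_m) (auto simp: tagged_partition_def)
  have sums: "(\<Sum>n<k. norm (x n) powr p) \<le> R powr p" for k
  proof -
    have "0 \<le> lp_norm (ereal p) x" by (simp add: lp_norm_def)
    then have "lp_norm (ereal p) x powr p \<le> R powr p"
      using R(2) p(1) by (intro powr_mono2) auto
    with sum_powr_le_lp_norm[OF p(1) x] show ?thesis by (rule order_trans)
  qed
  show ?thesis
    unfolding riemann_def \<alpha>(2) by (rule family_bound_combination[OF C E p \<alpha>(1) R(1) sums])
qed

lemma riemann_converges:
  assumes cont: "continuous_on UNIV f"
  shows "\<exists>y. (riemann f \<longlongrightarrow> y) partitions"
proof -
  have "cauchy_filter (filtermap (riemann f) partitions)"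
    unfolding cauchy_filter_metric_filtermap
  proof (intro allI impI)
    fix e :: real assume e: "0 < e"
    obtain \<delta> where \<delta>: "0 < \<delta>"
      "\<forall>I (E :: 'o \<times> 'o \<Rightarrow> 'a \<Rightarrow>\<^sub>L 'y) z w. sup_bounded M I E \<longrightarrow>
        (\<forall>i\<in>I. norm (f (z i) - f (w i)) < \<delta>) \<longrightarrow>
        norm (\<Sum>i\<in>I. blinfun_apply (E i) (f (z i) - f (w i))) \<le> e / 2"
      by (rule family_small[OF C M p x f, of "e / 2"]) (use e in auto)
    \<comment> \<open>Under this gauge \<open>f\<close> differs from its tag value by less than
      \<open>\<delta> / 2\<close> wherever a member is nonzero. Members of two such partitions that
      are nonzero at a common point have tags with values less than \<delta> apart.\<close>
    define d where "d w \<omega> = norm (f w - f \<omega>) * (2 / \<delta>)" for w \<omega>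
    have d: "d \<in> gauges"
      unfolding gauges_def d_def mem_Collect_eq
      by (intro allI conjI continuous_on_mult_right continuous_on_norm continuous_on_diff
          continuous_on_const cont) simp
    have "dist (riemann f P) (riemann f Q) < e"
      if P: "tagged_partition P" "finer d P" and Q: "tagged_partition Q" "finer d Q" for P Q
    proof -
      define I where "I = {(w, v) \<in> fst P \<times> fst Q. \<exists>\<omega>. snd P w \<omega> * snd Q v \<omega> \<noteq> 0}"
      have "norm (f (fst i) - f (snd i)) < \<delta>" if "i \<in> I" for i
      proof -
        obtain w v \<omega> where i: "i = (w, v)" "w \<in> fst P" "v \<in> fst Q" "snd P w \<omega> \<noteq> 0" "snd Q v \<omega> \<noteq> 0"
          using \<open>i \<in> I\<close> unfolding I_def by auto
        then have "d w \<omega> < 1" "d v \<omega> < 1"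
          using P(2) Q(2) by (auto simp: finer_def)
        then have "norm (f w - f \<omega>) < \<delta> / 2" "norm (f v - f \<omega>) < \<delta> / 2"
          using \<delta>(1) by (auto simp: d_def field_simps)
        then have "norm (f w - f v) < \<delta>"
          using norm_diff_triangle_less[of "f w" "f \<omega>" "\<delta> / 2" "f v" "\<delta> / 2"]
          by (simp add: norm_minus_commute)
        then show ?thesis by (simp add: i)
      qed
      then have "norm (riemann f P - riemann f Q) \<le> e / 2"
        unfolding riemann_diff(2)[OF P(1) Q(1)] I_def[symmetric]
        using \<delta>(2) riemann_diff(1)[OF P(1) Q(1)] unfolding I_def[symmetric] by blast
      then show ?thesis using e by (simp add: dist_norm)
    qed
    then show "\<exists>S. eventually S partitions \<and>
        (\<forall>P Q. S P \<and> S Q \<longrightarrow> dist (riemann f P) (riemann f Q) < e)"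
      by (intro exI[of _ "\<lambda>P. tagged_partition P \<and> finer d P"]) (auto simp: eventually_partitions intro: bexI[OF _ d])
  qed
  moreover have "filtermap (riemann f) partitions \<noteq> bot"
    by (simp add: filtermap_bot_iff partitions_not_bot[OF compact_UNIV])
  ultimately obtain y where "filtermap (riemann f) partitions \<le> nhds y"
    using cauchy_filter_complete_converges[of _ UNIV] complete_UNIV by auto
  then show ?thesis by (auto simp: filterlim_def)
qed

end

end

section \<open>The operator as a limit of Riemann sums\<close>

theorem corollary2p6:
  fixes scaleX :: "'k::real_or_complex \<Rightarrow> 'x::banach \<Rightarrow> 'x"
    and scaleY :: "'k \<Rightarrow> 'y::banach \<Rightarrow> 'y"
    and S :: "('o::t2_space \<Rightarrow>\<^sub>C 'k) \<Rightarrow>\<^sub>L ('x \<Rightarrow>\<^sub>L 'y)"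
    and p :: real
  assumes "normed_over scaleX" and "normed_over scaleY"
    and "has_cotype 2 (dual_space scaleX)"
    and "compact (UNIV :: 'o set)"
    and "S \<in> operators (scale_bcontfun (*)) (scale_blinfun scaleY)"
    and "range (blinfun_apply S) \<subseteq> operators scaleX scaleY"
    and "1 \<le> p" and "p \<le> 2"
  shows "\<exists>U \<in> Cp_operators p scaleX scaleY.
    sharp scaleX U = (\<lambda>\<phi> x. blinfun_apply (blinfun_apply S \<phi>) x)"
proof -
  interpret X: normed_over scaleX by fact
  interpret X: banach_over scaleX ..
  interpret Y: normed_over scaleY by fact
  interpret K: normed_over "(*) :: 'k \<Rightarrow> 'k \<Rightarrow> 'k" by (rule normed_over_mult)
  note p = assms(7,8)
  obtain C where C: "cotype_2_const C TYPE('x \<Rightarrow>\<^sub>L real)"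
    by (rule X.cotype_2_real_functionals[OF assms(3)]) (auto simp: cotype_2_const_def)
  have S_scale: "S (scale_bcontfun (*) c \<phi>) = scale_blinfun scaleY c (S \<phi>)" for c \<phi>
    using assms(5) unfolding operators_def mem_Collect_eq
    by (rule module_hom.scale[OF Vector_Spaces.linear.axioms(3)])
  have S_lin: "S \<phi> (scaleX c x) = scaleY c (S \<phi> x)" for \<phi> c x
  proof -
    have "S \<phi> \<in> operators scaleX scaleY" using assms(6) by blast
    then have "Vector_Spaces.linear scaleX scaleY (S \<phi>)" by (simp add: operators_def)
    then show ?thesis by (rule module_hom.scale[OF Vector_Spaces.linear.axioms(3)])
  qed
  define emb :: "('o \<Rightarrow> real) \<Rightarrow> ('o \<Rightarrow>\<^sub>C 'k)" where "emb g = Bcontfun (\<lambda>\<omega>. of_real (g \<omega>))" for g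
  have emb: "apply_bcontfun (emb g) \<omega> = of_real (g \<omega>)" if "continuous_on UNIV g" for g \<omega>
  proof -
    have "continuous_on UNIV (\<lambda>\<omega>. of_real (g \<omega>) :: 'k)"
      by (intro continuous_on_of_real that)
    moreover from this have "bounded (range (\<lambda>\<omega>. of_real (g \<omega>) :: 'k))"
      by (intro compact_imp_bounded compact_continuous_image assms(4))
    ultimately show ?thesis by (simp add: emb_def Bcontfun_inverse bcontfun_def)
  qed
  define m where "m g = S (emb g)" for g
  \<comment> \<open>Adding 1 keeps the bound positive even if \<open>S\<close> is 0.\<close>
  interpret I: operator_content scaleX m "norm S + 1"
  proof
    fix g h :: "'o \<Rightarrow> real" assume g: "continuous_on UNIV g" and h: "continuous_on UNIV h"
    have "emb (\<lambda>\<omega>. g \<omega> + h \<omega>) = emb g + emb h"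
      by (rule bcontfun_eqI) (simp add: emb g h continuous_on_add)
    then show "m (\<lambda>\<omega>. g \<omega> + h \<omega>) = m g + m h" by (simp add: m_def blinfun.add_right)
  next
    fix g :: "'o \<Rightarrow> real" and r assume g: "continuous_on UNIV g"
    have "emb (\<lambda>\<omega>. r * g \<omega>) = r *\<^sub>R emb g"
      by (rule bcontfun_eqI) (simp add: emb g continuous_on_mult_left scaleR_conv_of_real)
    then show "m (\<lambda>\<omega>. r * g \<omega>) = r *\<^sub>R m g" by (simp add: m_def blinfun.scaleR_right)
  next
    fix g :: "'o \<Rightarrow> real" assume g: "continuous_on UNIV g" and le: "\<And>\<omega>. \<bar>g \<omega>\<bar> \<le> 1"
    have "norm (emb g) \<le> 1" by (rule norm_bound) (simp add: emb g le)
    then have "norm S * norm (emb g) \<le> norm S * 1" by (rule mult_left_mono) simp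
    then show "norm (m g) \<le> norm S + 1"
      unfolding m_def using norm_blinfun[of S "emb g"] by simp
  qed (use assms(4) in \<open>auto simp: add_nonneg_pos\<close>)
  let ?F = "partitions :: 'o tagged_functions filter"
  have nb: "?F \<noteq> bot" by (rule partitions_not_bot[OF assms(4)])
  \<comment> \<open>Outside \<open>Cp_space\<close> the limit may fail to exist and the value is
    then arbitrary. On \<open>Cp_space\<close> every identity for \<open>U\<close> is obtained by
    computing a limit and appealing to its uniqueness.\<close>
  define U where "U f = Lim ?F (I.riemann (apply_bcontfun f))" for f
  have U_eq: "U f = y" if "(I.riemann (apply_bcontfun f) \<longlongrightarrow> y) ?F" for f y
    unfolding U_def by (rule tendsto_Lim[OF nb that])
  have hull: "\<exists>\<alpha>\<in>lp_ball (conj_index (ereal p)). apply_bcontfun f \<omega> = X.combination x \<alpha>"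
    if "range (apply_bcontfun f) \<subseteq> p_hull p scaleX x" for f :: "'o \<Rightarrow>\<^sub>C 'x" and x \<omega>
  proof -
    have "apply_bcontfun f \<omega> \<in> p_hull p scaleX x" using that by blast
    then obtain \<alpha> where "\<alpha> \<in> lp_ball (conj_index (ereal p))"
      "(\<lambda>n. scaleX (\<alpha> n) (x n)) sums apply_bcontfun f \<omega>"
      unfolding p_hull_def by blast
    then show ?thesis
      unfolding X.combination_def by (intro bexI[of _ \<alpha>]) (simp_all add: sums_iff)
  qed
  have U_lim: "(I.riemann (apply_bcontfun f) \<longlongrightarrow> U f) ?F" if "f \<in> Cp_space p scaleX" for f
  proof -
    obtain x where x: "in_lp (ereal p) x" "range (apply_bcontfun f) \<subseteq> p_hull p scaleX x"
      using \<open>f \<in> Cp_space p scaleX\<close> by (auto simp: Cp_space_def)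
    obtain y where "(I.riemann (apply_bcontfun f) \<longlongrightarrow> y) ?F"
      using I.riemann_converges[where f = "apply_bcontfun f", OF C p x(1) hull[OF x(2)]] continuous_on_apply_bcontfun by blast
    then show ?thesis using U_eq by simp
  qed
  have "U (f + g) = U f + U g" if "f \<in> Cp_space p scaleX" "g \<in> Cp_space p scaleX" for f g
  proof (rule U_eq)
    have "((\<lambda>P. I.riemann (apply_bcontfun f) P + I.riemann (apply_bcontfun g) P) \<longlongrightarrow> U f + U g) ?F"
      by (intro tendsto_add U_lim that)
    then show "(I.riemann (apply_bcontfun (f + g)) \<longlongrightarrow> U f + U g) ?F"
      by (simp add: plus_bcontfun.rep_eq flip: I.riemann_add)
  qed
  moreover have "U (scale_bcontfun scaleX c f) = scaleY c (U f)" if "f \<in> Cp_space p scaleX" for c f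
  proof (rule U_eq)
    have "((\<lambda>P. scaleY c (I.riemann (apply_bcontfun f) P)) \<longlongrightarrow> scaleY c (U f)) ?F"
      by (intro bounded_linear.tendsto[OF Y.bounded_linear_scale] U_lim that)
    moreover have "I.riemann (apply_bcontfun (scale_bcontfun scaleX c f)) =
        (\<lambda>P. scaleY c (I.riemann (apply_bcontfun f) P))"
      by (simp add: fun_eq_iff I.riemann_def X.apply_scale_bcontfun m_def S_lin Y.scale_sum_right)
    ultimately show "(I.riemann (apply_bcontfun (scale_bcontfun scaleX c f)) \<longlongrightarrow> scaleY c (U f)) ?F"
      by (simp only:)
  qed
  moreover define B where "B = 14 * C\<^sup>2 * (norm S + 1)"
  have B: "0 < B" using C by (simp add: B_def cotype_2_const_def add_nonneg_pos)
  have "norm (U f) \<le> B * Cp_norm p scaleX f" if f: "f \<in> Cp_space p scaleX" for f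
  proof -
    have "norm (U f) / B \<le> lp_norm (ereal p) x"
      if x: "in_lp (ereal p) x" "range (apply_bcontfun f) \<subseteq> p_hull p scaleX x" for x
    \<comment> \<open>The slack \<open>e\<close> supplies a positive \<open>R\<close> for the bound
      on Riemann sums; taking the infimum over all admissible \<open>x\<close> then produces the
      norm of \<open>f\<close>.\<close>
    proof (rule field_le_epsilon)
      fix e :: real assume e: "0 < e"
      let ?R = "lp_norm (ereal p) x + e"
      have "0 \<le> lp_norm (ereal p) x" using p by (simp add: lp_norm_def)
      then have R: "0 < ?R" "lp_norm (ereal p) x \<le> ?R" using e by auto
      have "norm (U f) \<le> B * ?R"
      proof (rule tendsto_upperbound[OF tendsto_norm[OF U_lim[OF f]] _ nb])
        have "norm (I.riemann (apply_bcontfun f) P) \<le> B * ?R" if "tagged_partition P" for P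
          unfolding B_def by (rule I.riemann_bound[where f = "apply_bcontfun f", OF C p x(1) hull[OF x(2)] that R])
        then show "\<forall>\<^sub>F P in ?F. norm (I.riemann (apply_bcontfun f) P) \<le> B * ?R"
          unfolding eventually_partitions by (intro bexI[of _ "\<lambda>_ _. 0"]) (auto simp: gauges_def)
      qed
      then show "norm (U f) / B \<le> ?R" using B by (simp add: field_simps)
    qed
    then have "norm (U f) / B \<le> Cp_norm p scaleX f"
      unfolding Cp_norm_def using f by (intro cInf_greatest) (auto simp: Cp_space_def)
    then show ?thesis using B by (simp add: field_simps)
  qed
  ultimately have "U \<in> Cp_operators p scaleX scaleY"
    unfolding Cp_operators_def by blast
  moreover have "U (scalar_times scaleX \<phi> x) = S \<phi> x" for \<phi> x
  proof (rule U_eq)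
    let ?\<phi> = "apply_bcontfun \<phi>"
    \<comment> \<open>Linearity of \<open>S\<close> and of its values over the scalars moves
      \<open>\<phi>(w)\<close> from the vector into the argument of \<open>S\<close>. The Riemann
      sum thus becomes \<open>S\<close> at a function that approximates \<phi> uniformly.\<close>
    define approx where "approx P = (\<Sum>w\<in>fst P. scale_bcontfun (*) (?\<phi> w) (emb (snd P w)))" for P
    have riemann: "I.riemann (apply_bcontfun (scalar_times scaleX \<phi> x)) = (\<lambda>P. S (approx P) x)"
      by (simp add: fun_eq_iff I.riemann_def X.apply_scalar_times m_def approx_def S_lin S_scale
          blinfun.sum_left blinfun.sum_right Y.apply_scale_blinfun)
    have "(approx \<longlongrightarrow> \<phi>) ?F"
    proof (rule tendstoI)
      fix e :: real assume e: "0 < e"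
      \<comment> \<open>With this gauge \<phi> differs from its tag value by less than
        \<open>e / 2\<close> wherever a member is nonzero, and averaging over the partition keeps
        this bound.\<close>
      define d where "d w \<omega> = norm (?\<phi> w - ?\<phi> \<omega>) * (2 / e)" for w \<omega>
      have d: "d \<in> gauges"
        unfolding gauges_def d_def mem_Collect_eq
        by (intro allI conjI continuous_on_mult_right continuous_on_norm continuous_on_diff
            continuous_on_const continuous_on_apply_bcontfun) simp
      have "dist (approx P) \<phi> < e" if P: "tagged_partition P" "finer d P" for P
      proof -
        have sum_apply: "apply_bcontfun (\<Sum>w\<in>W. g w) \<omega> = (\<Sum>w\<in>W. apply_bcontfun (g w) \<omega>)"
          for W :: "'o set" and g :: "'o \<Rightarrow> 'o \<Rightarrow>\<^sub>C 'k" and \<omega>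
          by (induction W rule: infinite_finite_induct) auto
        have "norm (apply_bcontfun (approx P - \<phi>) \<omega>) \<le> e / 2" for \<omega>
        proof -
          have "apply_bcontfun (approx P) \<omega> = (\<Sum>w\<in>fst P. ?\<phi> w * of_real (snd P w \<omega>))"
            unfolding approx_def sum_apply using P(1)
            by (intro sum.cong refl) (simp add: K.apply_scale_bcontfun emb tagged_partition_def)
          moreover have "?\<phi> \<omega> = (\<Sum>w\<in>fst P. ?\<phi> \<omega> * of_real (snd P w \<omega>))"
            using P(1) by (simp add: tagged_partition_def flip: sum_distrib_left of_real_sum)
          ultimately have "apply_bcontfun (approx P - \<phi>) \<omega> = (\<Sum>w\<in>fst P. (?\<phi> w - ?\<phi> \<omega>) * of_real (snd P w \<omega>))"
            by (simp add: left_diff_distrib sum_subtractf)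
          also have "norm \<dots> \<le> (\<Sum>w\<in>fst P. e / 2 * snd P w \<omega>)"
          proof (intro norm_sum[THEN order_trans] sum_mono)
            fix w assume w: "w \<in> fst P"
            have "0 \<le> snd P w \<omega>" using P(1) w by (simp add: tagged_partition_def)
            moreover have "norm (?\<phi> w - ?\<phi> \<omega>) \<le> e / 2" if "snd P w \<omega> \<noteq> 0"
            proof -
              have "d w \<omega> < 1" using P(2) w that by (simp add: finer_def)
              then show ?thesis using e by (simp add: d_def field_simps)
            qed
            ultimately show "norm ((?\<phi> w - ?\<phi> \<omega>) * of_real (snd P w \<omega>)) \<le> e / 2 * snd P w \<omega>"
              by (cases "snd P w \<omega> = 0") (auto simp: norm_mult intro!: mult_right_mono)
          qed
          also have "\<dots> = e / 2"
            unfolding sum_distrib_left[symmetric] using P(1) by (simp add: tagged_partition_def)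
          finally show ?thesis .
        qed
        then have "norm (approx P - \<phi>) \<le> e / 2" by (rule norm_bound)
        then show ?thesis using e by (simp add: dist_norm)
      qed
      then show "\<forall>\<^sub>F P in ?F. dist (approx P) \<phi> < e"
        unfolding eventually_partitions using d by blast
    qed
    then have "((\<lambda>P. S (approx P) x) \<longlongrightarrow> S \<phi> x) ?F"
      by (intro tendsto_intros)
    then show "(I.riemann (apply_bcontfun (scalar_times scaleX \<phi> x)) \<longlongrightarrow> S \<phi> x) ?F"
      by (simp only: riemann)
  qed
  then have "sharp scaleX U = (\<lambda>\<phi> x. S \<phi> x)"
    by (simp add: sharp_def fun_eq_iff)
  ultimately show ?thesis by blast
qed

end
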